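(* If $k\le 2p-2\le q$ and $G\subset\mathbb{F}_q^k$ is an arc of size $2k-2$, then the matrix $M_G^{\uparrow 1}$ has full row rank over $\mathbb{F}_q$. Hence, if $q$ is not prime, then $g(k,q)=q+1$ when $k\le 2p-2$.
   Context: $\mathbb{F}_q$ is a finite field of order $q$ and characteristic $p$. An arc in $\mathbb{F}_q^k$ is an ordered family of at least $k$ vectors in which every subfamily of size $k$ is a basis of $\mathbb{F}_q^k$; subfamilies inherit the order. $g(k,q)$ denotes the maximum size of an arc in $\mathbb{F}_q^k$. For a finite set $X$, $\binom{X}{m}$ is the set of $m$-subsets of $X$. For a basis $B$ of $\mathbb{F}_q^k$, a vector $u$ and $C\in\binom{G}{k-1}$, $\det(u,C)_B$ is the determinant of the $k\times k$ matrix whose first row is $u$ written with respect to $B$ and whose last $k-1$ rows are the elements of $C$ written with respect to $B$ in the order inherited from $G$. For an arc $G$ and fixed basis $B$, $M_G^{\uparrow 1}$ is the matrix with rows indexed by $\binom{G}{k-1}$, columns indexed by pairs $(\{u\},A)$ with $u\in G$ and $A\in\binom{G\setminus\{u\}}{k-2}$, and $(C,(\{u\},A))$-entry $\det(u,C)_B$ if $A\subset C\subset G\setminus\{u\}$ and $0$ otherwise. *)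

theory Defs
  imports
    "HOL-Library.Cardinality"
    "HOL-Computational_Algebra.Computational_Algebra"
    "Jordan_Normal_Form.Determinant"
    "Jordan_Normal_Form.DL_Rank"
begin

text \<open>
  The space \<open>\<bbbF>\<^sub>q\<^sup>k\<close> is \<open>carrier_vec k\<close> over a type \<open>'a\<close> of classes \<open>field\<close> and \<open>finite\<close>, with
  \<open>q = CARD('a)\<close> and \<open>p = CHAR('a)\<close>. An ordered family is a list; a subfamily is given by its set
  \<open>I\<close> of positions and inherits the order as \<open>nths G I\<close>.
\<close>

definition basis_family :: "nat \<Rightarrow> 'a::field vec list \<Rightarrow> bool" where
  "basis_family k B \<longleftrightarrow>
     distinct B \<and> vectorspace.basis class_ring (module_vec TYPE('a) k) (set B)"

definition is_arc :: "nat \<Rightarrow> 'a::field vec list \<Rightarrow> bool" where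
  "is_arc k G \<longleftrightarrow>
     set G \<subseteq> carrier_vec k \<and> k \<le> length G \<and>
     (\<forall>I. I \<subseteq> {..<length G} \<and> card I = k \<longrightarrow> basis_family k (nths G I))"

text \<open>
  \<open>g(k,q)\<close>; the field is passed as a type. The maximum exists for \<open>k \<ge> 2\<close> only: a family in
  \<open>\<bbbF>\<^sub>q\<^sup>1\<close> may repeat a nonzero vector arbitrarily often.
\<close>

definition max_arc_size :: "'a::{field,finite} itself \<Rightarrow> nat \<Rightarrow> nat" where
  "max_arc_size _ k = Max {length G | G :: 'a vec list. is_arc k G}"

definition coords :: "nat \<Rightarrow> 'a::field vec list \<Rightarrow> 'a vec \<Rightarrow> 'a vec" where
  "coords k B u = (THE c. c \<in> carrier_vec k \<and> mat_of_cols k B *\<^sub>v c = u)"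

definition det_wrt :: "nat \<Rightarrow> 'a::field vec list \<Rightarrow> 'a vec \<Rightarrow> 'a vec list \<Rightarrow> 'a" where
  "det_wrt k B u C = det (mat_of_rows k (map (coords k B) (u # C)))"

text \<open>
  Library matrices are indexed by numbers, so the index sets of the matrix are enumerated by
  lists. The rank does not depend on the enumeration.
\<close>

definition subsets_list :: "nat \<Rightarrow> nat \<Rightarrow> nat set list" where
  "subsets_list n m = filter (\<lambda>X. card X = m) (map set (subseqs [0..<n]))"

definition arc_row_index :: "nat \<Rightarrow> nat \<Rightarrow> nat set list" where
  "arc_row_index k n = subsets_list n (k - 1)"

definition arc_col_index :: "nat \<Rightarrow> nat \<Rightarrow> (nat \<times> nat set) list" where
  "arc_col_index k n =
     filter (\<lambda>(u, A). u \<notin> A) (List.product [0..<n] (subsets_list n (k - 2)))"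

definition arc_matrix :: "nat \<Rightarrow> 'a::field vec list \<Rightarrow> 'a vec list \<Rightarrow> 'a mat" where
  "arc_matrix k B G =
     (let n = length G; rs = arc_row_index k n; cs = arc_col_index k n in
      mat (length rs) (length cs) (\<lambda>(i, j).
        let C = rs ! i; (u, A) = cs ! j in
        if A \<subseteq> C \<and> C \<subseteq> {..<n} - {u} then det_wrt k B (G ! u) (nths G C) else 0))"

definition full_row_rank :: "'a::field mat \<Rightarrow> bool" where
  "full_row_rank M \<longleftrightarrow> vec_space.rank (dim_row M) M = dim_row M"

lemma set_subsets_list: "set (subsets_list n m) = {X. X \<subseteq> {..<n} \<and> card X = m}"
  using subseqs_powset[of "[0..<n]"] by (auto simp: subsets_list_def atLeast0LessThan)

lemma distinct_subsets_list: "distinct (subsets_list n m)"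
  by (simp add: subsets_list_def distinct_set_subseqs)

lemma set_arc_row_index: "set (arc_row_index k n) = {C. C \<subseteq> {..<n} \<and> card C = k - 1}"
  by (simp add: arc_row_index_def set_subsets_list)

lemma distinct_arc_row_index: "distinct (arc_row_index k n)"
  by (simp add: arc_row_index_def distinct_subsets_list)

lemma set_arc_col_index:
  "set (arc_col_index k n) = {(u, A). u < n \<and> A \<subseteq> {..<n} - {u} \<and> card A = k - 2}"
  by (auto simp: arc_col_index_def set_subsets_list)

lemma distinct_arc_col_index: "distinct (arc_col_index k n)"
  by (simp add: arc_col_index_def distinct_product distinct_subsets_list)

end

theory Submission
  imports Defs "HOL-Number_Theory.Cong"
begin

text \<open>
  Write \<open>m = k - 1\<close> and \<open>v\<^sub>C(u) = \<beta>\<^sub>C det(u, C)\<close> for a row relation \<open>\<beta>\<close> of the matrix, so that \<open>v\<^sub>C\<close> is a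
  functional vanishing on \<open>C\<close> and the column equations say that \<open>\<Sum>\<^bsub>C \<supseteq> A\<^esub> v\<^sub>C = 0\<close> for all \<open>A\<close> of size
  \<open>m - 1\<close>. Put \<open>S\<^sub>J = \<Sum>\<^bsub>C \<supseteq> J\<^esub> v\<^sub>C\<close>. Double counting gives \<open>(m - |J|) S\<^sub>J = 0\<close>, so for \<open>|J| < m\<close> only
  \<open>|J| = m - p\<close> can give a nonzero \<open>S\<^sub>J\<close>. If all these vanish, inclusion-exclusion yields
  \<open>v\<^bsub>X - C\<^esub> = (-1)\<^sup>m v\<^sub>C\<close>, and this functional vanishes on \<open>C\<close> and on its complement.

  To see that \<open>S\<^sub>J = 0\<close> for \<open>|J| = j = m - p\<close>, take alternating sums over the transversals of \<open>j\<close>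
  disjoint pairs of points. The alternating sum \<open>s\<close> of the \<open>S\<^sub>J\<close> agrees, up to sign, with the one of the
  \<open>v\<^sub>C\<close> at all points outside \<open>C\<close>. A linear dependency \<open>\<lambda>\<close> among \<open>k + 1\<close> points off the pairs then gives
  \<open>\<Sum>\<^bsub>u \<in> B\<^esub> \<lambda>\<^sub>u s(u) = 0\<close> for every \<open>(j + 2)\<close>-subset \<open>B\<close>, so that \<open>\<lambda>\<^sub>u s(u)\<close> is constant and is killed by
  \<open>j + 2 < p\<close>; this is where \<open>k \<le> 2p - 2\<close> enters. The pairs are then removed one at a time.

  An arc \<open>S\<close> of size \<open>q + 2\<close> would produce a nonzero relation on any \<open>G \<subseteq> S\<close> of size \<open>2k - 2\<close>, namely
  \<open>\<beta>\<^sub>C = 1 / (\<Prod>\<^bsub>w \<in> S - C\<^esub> det(w, C) \<Prod>\<^bsub>z \<in> G - C\<^esub> det(z, C))\<close>. For fixed \<open>A\<close> and \<open>u\<close>, projecting from \<open>A\<close>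
  to a line with \<open>u\<close> at infinity turns the column equation into the vanishing of a divided difference on
  \<open>k - 1\<close> nodes of the polynomial \<open>\<Prod>(r - t)\<close> over the \<open>k - 3\<close> field elements \<open>r\<close> that are not slopes.
\<close>

section \<open>Alternating sums over disjoint pairs\<close>

fun pair_points :: "('i \<times> 'i) list \<Rightarrow> 'i list" where
  "pair_points [] = []"
| "pair_points ((x, y) # ps) = x # y # pair_points ps"

text \<open>
  The signed sum of \<open>f (J \<union> Z)\<close> over all transversals \<open>Z\<close> of the pairs \<open>ps\<close>.
\<close>

fun swap_diff :: "('i set \<Rightarrow> 'a::comm_ring_1) \<Rightarrow> ('i \<times> 'i) list \<Rightarrow> 'i set \<Rightarrow> 'a" where
  "swap_diff f [] J = f J"
| "swap_diff f ((x, y) # ps) J = swap_diff f ps (insert x J) - swap_diff f ps (insert y J)"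

lemma length_pair_points: "length (pair_points ps) = 2 * length ps"
  by (induction ps rule: pair_points.induct) auto

text \<open>Every set that occurs is \<open>J\<close> with one point of each pair added. Relations
  that hold only for m-sets can therefore be used under the alternating sum.\<close>

lemma swap_diff_cong:
  assumes "finite J" "distinct (pair_points ps)" "set (pair_points ps) \<inter> J = {}"
    and "\<And>C. J \<subseteq> C \<Longrightarrow> C \<subseteq> J \<union> set (pair_points ps) \<Longrightarrow> card C = card J + length ps \<Longrightarrow> f C = g C"
  shows "swap_diff f ps J = swap_diff g ps J"
  using assms
proof (induction f ps J rule: swap_diff.induct)
  case (2 f x y ps J)
  have "swap_diff f ps (insert x J) = swap_diff g ps (insert x J)"
    by (rule "2.IH"(1)) (use "2.prems" in \<open>auto intro!: "2.prems"(4)\<close>)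
  moreover have "swap_diff f ps (insert y J) = swap_diff g ps (insert y J)"
    by (rule "2.IH"(2)) (use "2.prems" in \<open>auto intro!: "2.prems"(4)\<close>)
  ultimately show ?case by simp
qed auto

lemma swap_diff_0 [simp]: "swap_diff (\<lambda>_. 0) ps J = 0"
  by (induction ps arbitrary: J rule: pair_points.induct) auto

lemma swap_diff_mult_left: "swap_diff (\<lambda>C. c * f C) ps J = c * swap_diff f ps J"
  by (induction ps arbitrary: J rule: pair_points.induct) (auto simp: algebra_simps)

lemma swap_diff_sum: "swap_diff (\<lambda>C. \<Sum>u\<in>U. f u C) ps J = (\<Sum>u\<in>U. swap_diff (f u) ps J)"
  by (induction ps arbitrary: J rule: pair_points.induct) (auto simp: sum_subtractf)

text \<open>In \<open>swap_diff_sum_subsets\<close> the offset \<open>r\<close> is the number of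
  pairs still to be processed.\<close>

lemma sum_subsets_insert:
  fixes g :: "'i set \<Rightarrow> 'a::comm_monoid_add"
  assumes "finite C" "x \<notin> C"
  shows "(\<Sum>J | J \<subseteq> insert x C \<and> card J + r = j. g J) =
         (\<Sum>J | J \<subseteq> C \<and> card J + r = j. g J) + (\<Sum>J | J \<subseteq> C \<and> card J + Suc r = j. g (insert x J))"
proof -
  have fin: "finite {J. J \<subseteq> insert x C \<and> card J + r = j}" "finite {J. J \<subseteq> C \<and> card J + Suc r = j}"
    "finite {J. J \<subseteq> C \<and> card J + r = j}"
    using assms(1) by (auto intro: finite_subset[OF _ finite_Pow_iff[THEN iffD2, of "insert x C"]])
  have inj: "inj_on (insert x) {J. J \<subseteq> C \<and> card J + Suc r = j}"
    using assms(2) unfolding inj_on_def by (metis (no_types, lifting) insert_ident mem_Collect_eq subsetD)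
  have card: "card (insert x J) = Suc (card J)" if "J \<subseteq> C" for J
    using that assms finite_subset[OF that] by (subst card_insert_disjoint) auto
  have split: "{J. J \<subseteq> insert x C \<and> card J + r = j} =
      {J. J \<subseteq> C \<and> card J + r = j} \<union> insert x ` {J. J \<subseteq> C \<and> card J + Suc r = j}" (is "?L = ?R")
  proof (intro equalityI subsetI)
    fix J assume J: "J \<in> ?L"
    show "J \<in> ?R"
    proof (cases "x \<in> J")
      case True
      then have "J = insert x (J - {x})" "J - {x} \<subseteq> C" using J by auto
      moreover have "card (J - {x}) + Suc r = j"
        using J card[OF calculation(2)] calculation(1) by auto
      ultimately show ?thesis by blast
    qed (use J in auto)
  qed (use card in auto)
  show ?thesis
    unfolding split
    by (subst sum.union_disjoint) (use fin assms(2) in \<open>auto simp: sum.reindex[OF inj[simplified]]\<close>)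
qed

text \<open>A subset that misses some pair occurs for both choices from that pair, with opposite
  signs. What survives is a full transversal together with \<open>j - length ps\<close> points of
  \<open>C\<close>.\<close>

lemma swap_diff_sum_subsets:
  assumes "finite C" "distinct (pair_points ps)" "set (pair_points ps) \<inter> C = {}"
  shows "swap_diff (\<lambda>C. \<Sum>J | J \<subseteq> C \<and> card J = j. f J) ps C =
         (\<Sum>J | J \<subseteq> C \<and> card J + length ps = j. swap_diff f ps J)"
  using assms
proof (induction ps arbitrary: C rule: pair_points.induct)
  case (2 x y ps)
  show ?case
    using 2 by (simp add: sum_subsets_insert sum_subtractf)
qed simp

text \<open>On the right \<open>x\<close> may also be the unchosen point of a pair. Such a term is
  symmetric in the two points of the pair, so it cancels in the difference.\<close>

lemma sum_swap_diff_insert: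
  assumes "finite X" "J \<subseteq> X" "distinct (pair_points ps)" "set (pair_points ps) \<inter> J = {}"
    "set (pair_points ps) \<subseteq> X"
  shows "(\<Sum>x \<in> X - set (pair_points ps) - J. swap_diff f ps (insert x J)) =
         swap_diff (\<lambda>J. \<Sum>x \<in> X - J. f (insert x J)) ps J"
  using assms
proof (induction ps arbitrary: J rule: pair_points.induct)
  case (2 a b ps)
  let ?P = "set (pair_points ps)"
  let ?D = "X - set (pair_points ((a, b) # ps)) - J"
  have eq: "(\<Sum>x \<in> X - ?P - insert c J. swap_diff f ps (insert x (insert c J))) =
      swap_diff f ps (insert d (insert c J)) + (\<Sum>x \<in> ?D. swap_diff f ps (insert c (insert x J)))"
    if "{c, d} = {a, b}" for c d
  proof -
    have "X - ?P - insert c J = insert d ?D" "d \<notin> ?D"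
      using that 2(2-) by (auto simp: doubleton_eq_iff)
    then show ?thesis using 2(2) by (simp add: insert_commute)
  qed
  have "swap_diff (\<lambda>J. \<Sum>x \<in> X - J. f (insert x J)) ((a, b) # ps) J =
     (\<Sum>x \<in> X - ?P - insert a J. swap_diff f ps (insert x (insert a J))) -
     (\<Sum>x \<in> X - ?P - insert b J. swap_diff f ps (insert x (insert b J)))"
    using 2 by simp
  also have "\<dots> = (\<Sum>x \<in> ?D. swap_diff f ps (insert a (insert x J))) - (\<Sum>x \<in> ?D. swap_diff f ps (insert b (insert x J)))"
    using eq[of a b] eq[of b a] by (simp add: insert_commute)
  finally show ?case by (simp add: sum_subtractf)
qed auto

lemma sum_minus_one_power_card_subsets:
  assumes "finite F"
  shows "(\<Sum>J | J \<subseteq> F. (- 1) ^ card J) = (if F = {} then 1 else 0 :: 'a::comm_ring_1)"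
proof (cases "F = {}")
  case False
  then obtain x F' where F: "F = insert x F'" "x \<notin> F'" by (meson mk_disjoint_insert ex_in_conv)
  then have fin: "finite F'" using assms by simp
  have inj: "inj_on (insert x) {J. J \<subseteq> F'}"
    using F(2) unfolding inj_on_def by (metis insert_ident mem_Collect_eq subsetD)
  have split: "{J. J \<subseteq> F} = {J. J \<subseteq> F'} \<union> insert x ` {J. J \<subseteq> F'}"
    unfolding F(1) using Pow_insert[of x F'] by (auto simp: Pow_def)
  have "(\<Sum>J | J \<subseteq> F. (- 1) ^ card J) = (\<Sum>J | J \<subseteq> F'. (- 1) ^ card J :: 'a) + (\<Sum>J | J \<subseteq> F'. (- 1) ^ card (insert x J))"
    unfolding split using fin F(2)
    by (subst sum.union_disjoint) (auto simp: sum.reindex[OF inj])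
  also have "(\<Sum>J | J \<subseteq> F'. (- 1) ^ card (insert x J) :: 'a) = (\<Sum>J | J \<subseteq> F'. - ((- 1) ^ card J))"
  proof (rule sum.cong)
    fix J assume "J \<in> {J. J \<subseteq> F'}"
    then have "card (insert x J) = Suc (card J)"
      using F(2) fin by (subst card_insert_disjoint) (auto dest: finite_subset)
    then show "(- 1) ^ card (insert x J) = - ((- 1) ^ card J :: 'a)" by simp
  qed simp
  finally show ?thesis using False by (simp add: sum_negf)
qed simp

section \<open>Systems of functionals with cancelling superset sums\<close>

text \<open>The properties of \<open>v C u\<close> = beta_C det(u, C) that the argument uses, with
  \<open>m = k - 1\<close>. Thus \<open>m_bound\<close> is \<open>k <= 2p - 2\<close>,
  \<open>cancel\<close> holds the column equations, and \<open>dependency\<close> concerns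
  \<open>k + 1\<close> points of an arc, with coefficients common to all \<open>C\<close>.\<close>

locale cancelling_system =
  fixes X :: "'i set" and m :: nat and v :: "'i set \<Rightarrow> 'i \<Rightarrow> 'a::field"
  assumes finite_X: "finite X" and card_X: "card X = 2 * m"
    and prime_CHAR: "prime CHAR('a)" and m_bound: "m + 3 \<le> 2 * CHAR('a)"
    and vanish: "\<And>C u. C \<subseteq> X \<Longrightarrow> card C = m \<Longrightarrow> u \<in> C \<Longrightarrow> v C u = 0"
    and dependency: "\<And>U. U \<subseteq> X \<Longrightarrow> card U = m + 2 \<Longrightarrow>
      \<exists>l. (\<forall>u\<in>U. l u \<noteq> 0) \<and> (\<forall>C. C \<subseteq> X \<and> card C = m \<longrightarrow> (\<Sum>u\<in>U. l u * v C u) = 0)"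
    and cancel: "\<And>A u. A \<subseteq> X \<Longrightarrow> Suc (card A) = m \<Longrightarrow> u \<in> X \<Longrightarrow> (\<Sum>x\<in>X - A. v (insert x A) u) = 0"
begin

section \<open>Double counting and inclusion-exclusion for superset sums\<close>

definition superset_sum :: "'i set \<Rightarrow> 'i \<Rightarrow> 'a" where
  "superset_sum J u = (\<Sum>C | C \<subseteq> X \<and> card C = m \<and> J \<subseteq> C. v C u)"

lemma finite_subsets [simp]: "finite {C. C \<subseteq> X \<and> Q C}"
  using finite_X by (auto intro: finite_subset[OF _ finite_Pow_iff[THEN iffD2, of X]])

lemma finite_if_subset: "C \<subseteq> X \<Longrightarrow> finite C"
  using finite_X by (rule finite_subset[rotated])

lemma sum_card_times:
  assumes "J \<subseteq> X" "card J \<le> m"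
  shows "(\<Sum>C | C \<subseteq> X \<and> card C = m \<and> J \<subseteq> C. \<Sum>x\<in>C - J. v C u) = of_nat (m - card J) * superset_sum J u"
proof -
  have "card (C - J) = m - card J" if "C \<subseteq> X" "card C = m" "J \<subseteq> C" for C
    using that card_Diff_subset[of J C] finite_if_subset[of J] assms by auto
  then show ?thesis
    unfolding superset_sum_def by (simp add: sum_distrib_left)
qed

lemma sum_superset_sum_insert:
  assumes "J \<subseteq> X" "card J \<le> m"
  shows "(\<Sum>x\<in>X - J. superset_sum (insert x J) u) = of_nat (m - card J) * superset_sum J u"
proof -
  have "(\<Sum>x\<in>X - J. superset_sum (insert x J) u) =
      (\<Sum>(x, C)\<in>(SIGMA x:X - J. {C. C \<subseteq> X \<and> card C = m \<and> insert x J \<subseteq> C}). v C u)"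
    unfolding superset_sum_def using finite_X by (subst sum.Sigma) auto
  also have "\<dots> = (\<Sum>(C, x)\<in>(SIGMA C:{C. C \<subseteq> X \<and> card C = m \<and> J \<subseteq> C}. C - J). v C u)"
    by (rule sum.reindex_bij_witness[of _ "\<lambda>(C, x). (x, C)" "\<lambda>(x, C). (C, x)"]) auto
  also have "\<dots> = (\<Sum>C | C \<subseteq> X \<and> card C = m \<and> J \<subseteq> C. \<Sum>x\<in>C - J. v C u)"
    by (subst sum.Sigma) (auto dest: finite_if_subset)
  finally show ?thesis using sum_card_times[OF assms] by simp
qed

text \<open>Pairs of a \<open>C\<close> containing \<open>J\<close> and a point \<open>x\<close> of
  \<open>C - J\<close> are counted twice. Grouped by \<open>C\<close> they give
  \<open>m - card J\<close> times the superset sum; grouped by \<open>A = C - {x}\<close> each inner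
  sum is a column equation.\<close>

lemma superset_sum_eq_0:
  assumes "J \<subseteq> X" "card J < m" "u \<in> X" "\<not> CHAR('a) dvd m - card J"
  shows "superset_sum J u = 0"
proof -
  have "of_nat (m - card J) * superset_sum J u =
      (\<Sum>C | C \<subseteq> X \<and> card C = m \<and> J \<subseteq> C. \<Sum>x\<in>C - J. v C u)"
    using sum_card_times[of J u] assms by simp
  also have "\<dots> = (\<Sum>(C, x)\<in>(SIGMA C:{C. C \<subseteq> X \<and> card C = m \<and> J \<subseteq> C}. C - J). v C u)"
    by (subst sum.Sigma) (auto dest: finite_if_subset)
  also have "\<dots> = (\<Sum>(A, x)\<in>(SIGMA A:{A. A \<subseteq> X \<and> Suc (card A) = m \<and> J \<subseteq> A}. X - A). v (insert x A) u)"
  proof (rule sum.reindex_bij_witness[of _ "\<lambda>(A, x). (insert x A, x)" "\<lambda>(C, x). (C - {x}, x)"], goal_cases)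
    case (2 a)
    then show ?case using finite_if_subset by (auto simp: card_Diff_singleton) (metis Suc_pred card_gt_0_iff empty_iff finite_if_subset)
  next
    case (4 b)
    then show ?case using finite_if_subset by (auto simp: card_insert_if)
  qed (auto simp: insert_absorb)
  also have "\<dots> = (\<Sum>A | A \<subseteq> X \<and> Suc (card A) = m \<and> J \<subseteq> A. \<Sum>x\<in>X - A. v (insert x A) u)"
    using finite_X by (subst sum.Sigma) auto
  also have "\<dots> = 0"
    using cancel assms(3) by (intro sum.neutral) auto
  finally show ?thesis
    using assms(4) by (simp add: of_nat_eq_0_iff_char_dvd)
qed

text \<open>After exchanging the sums, \<open>v D\<close> is multiplied by the alternating sum over
  the subsets of \<open>C \<inter> D\<close>, which is 0 unless \<open>C\<close> and
  \<open>D\<close> are disjoint. As \<open>X\<close> has \<open>2m\<close> points, only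
  \<open>D = X - C\<close> remains.\<close>

lemma inclusion_exclusion:
  assumes "C \<subseteq> X" "card C = m"
  shows "v (X - C) u = (\<Sum>J | J \<subseteq> C. (- 1) ^ card J * superset_sum J u)"
proof -
  note fin = finite_if_subset[OF assms(1)]
  have "(\<Sum>J | J \<subseteq> C. (- 1) ^ card J * superset_sum J u) =
      (\<Sum>J\<in>{J. J \<subseteq> C}. \<Sum>D\<in>{D. D \<subseteq> X \<and> card D = m}. if J \<subseteq> D then (- 1) ^ card J * v D u else 0)"
    unfolding superset_sum_def
    by (intro sum.cong refl) (auto simp: sum_distrib_left sum.inter_filter[symmetric] Collect_conj_eq[symmetric] conj_ac intro!: sum.cong)
  also have "\<dots> = (\<Sum>D\<in>{D. D \<subseteq> X \<and> card D = m}. \<Sum>J\<in>{J. J \<subseteq> C}. if J \<subseteq> D then (- 1) ^ card J * v D u else 0)"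
    by (rule sum.swap)
  also have "\<dots> = (\<Sum>D\<in>{D. D \<subseteq> X \<and> card D = m}. if D = X - C then v D u else 0)"
  proof (rule sum.cong)
    fix D assume D: "D \<in> {D. D \<subseteq> X \<and> card D = m}"
    have "(\<Sum>J\<in>{J. J \<subseteq> C}. if J \<subseteq> D then (- 1) ^ card J * v D u else 0) =
        (\<Sum>J | J \<subseteq> C \<inter> D. (- 1) ^ card J) * v D u"
      using fin by (auto simp: sum_distrib_right sum.inter_filter[symmetric] intro!: sum.cong)
    also have "\<dots> = (if C \<inter> D = {} then v D u else 0)"
      using sum_minus_one_power_card_subsets[of "C \<inter> D", where ?'a = 'a] fin by (simp del: Int_subset_iff)
    also have "C \<inter> D = {} \<longleftrightarrow> D = X - C"
    proof
      assume "C \<inter> D = {}"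
      then have "D \<subseteq> X - C" using D by auto
      moreover have "card (X - C) = card D"
        using assms D card_X fin by (simp add: card_Diff_subset)
      ultimately show "D = X - C" using finite_X by (intro card_subset_eq) auto
    qed auto
    finally show "(\<Sum>J\<in>{J. J \<subseteq> C}. if J \<subseteq> D then (- 1) ^ card J * v D u else 0) =
      (if D = X - C then v D u else 0)" .
  qed simp
  also have "\<dots> = v (X - C) u"
    using assms card_X fin by (simp add: card_Diff_subset)
  finally show ?thesis ..
qed

lemma superset_sum_full:
  assumes "C \<subseteq> X" "card C = m"
  shows "superset_sum C u = v C u"
proof -
  have "{D. D \<subseteq> X \<and> card D = m \<and> C \<subseteq> D} = {C}"
    using assms card_subset_eq[of _ C] finite_if_subset by blast
  then show ?thesis by (simp add: superset_sum_def)
qed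

lemma not_CHAR_dvd: "0 < n \<Longrightarrow> n < 2 * CHAR('a) \<Longrightarrow> n \<noteq> CHAR('a) \<Longrightarrow> \<not> CHAR('a) dvd n"
proof
  assume "0 < n" "n < 2 * CHAR('a)" "n \<noteq> CHAR('a)" "CHAR('a) dvd n"
  then obtain c where "n = CHAR('a) * c" by (elim dvdE)
  with \<open>0 < n\<close> \<open>n < 2 * CHAR('a)\<close> \<open>n \<noteq> CHAR('a)\<close> have "0 < c" "c < 2" "c \<noteq> 1"
    by (auto simp: mult.commute[of 2])
  then show False by simp
qed

text \<open>Since \<open>m < 2p\<close>, double counting kills every term of inclusion-exclusion
  except those with \<open>card J = m\<close> and \<open>card J = m - p\<close>.\<close>

lemma complement_relation:
  assumes "C \<subseteq> X" "card C = m" "u \<in> X" "CHAR('a) \<le> m"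
  shows "v (X - C) u = (- 1) ^ m * v C u +
    (- 1) ^ (m - CHAR('a)) * (\<Sum>J | J \<subseteq> C \<and> card J = m - CHAR('a). superset_sum J u)"
proof -
  note fin = finite_if_subset[OF assms(1)]
  have CHAR: "0 < CHAR('a)" using prime_CHAR prime_gt_0_nat by blast
  let ?K = "{J. J \<subseteq> C \<and> card J = m - CHAR('a)}"
  have "v (X - C) u = (\<Sum>J | J \<subseteq> C. (- 1) ^ card J * superset_sum J u)"
    by (rule inclusion_exclusion) fact+
  also have "\<dots> = (\<Sum>J\<in>insert C ?K. (- 1) ^ card J * superset_sum J u)"
  proof (rule sum.mono_neutral_right)
    show "\<forall>J\<in>{J. J \<subseteq> C} - insert C ?K. (- 1) ^ card J * superset_sum J u = 0"
    proof
      fix J assume J: "J \<in> {J. J \<subseteq> C} - insert C ?K"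
      then have lt: "card J < m" using assms(2) fin by (auto intro!: psubset_card_mono)
      moreover have "\<not> CHAR('a) dvd m - card J"
        by (rule not_CHAR_dvd) (use lt J m_bound in auto)
      ultimately have "superset_sum J u = 0"
        using J assms by (intro superset_sum_eq_0) auto
      then show "(- 1) ^ card J * superset_sum J u = 0" by simp
    qed
  qed (use fin in auto)
  also have "\<dots> = (- 1) ^ card C * superset_sum C u + (\<Sum>J\<in>?K. (- 1) ^ card J * superset_sum J u)"
    using fin assms CHAR by (subst sum.insert) auto
  also have "(\<Sum>J\<in>?K. (- 1) ^ card J * superset_sum J u) =
      (- 1) ^ (m - CHAR('a)) * (\<Sum>J\<in>?K. superset_sum J u)"
    by (auto simp: sum_distrib_left intro!: sum.cong)
  finally show ?thesis using assms by (simp add: superset_sum_full)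
qed

text \<open>For \<open>u\<close> outside \<open>C\<close>, inclusion-exclusion leaves
  \<open>v (X - C) u = (- 1) ^ m * v C u\<close>, and the left side vanishes because
  \<open>u\<close> lies in \<open>X - C\<close>.\<close>

lemma v_eq_0I:
  assumes "\<And>J u. J \<subseteq> X \<Longrightarrow> u \<in> X \<Longrightarrow> card J < m \<Longrightarrow> superset_sum J u = 0"
    and "C \<subseteq> X" "card C = m" "u \<in> X"
  shows "v C u = 0"
proof (cases "u \<in> C")
  case True
  then show ?thesis using vanish assms by blast
next
  case False
  note fin = finite_if_subset[OF assms(2)]
  have "v (X - C) u = (\<Sum>J | J \<subseteq> C. (- 1) ^ card J * superset_sum J u)"
    by (rule inclusion_exclusion) fact+
  also have "\<dots> = (\<Sum>J\<in>{C}. (- 1) ^ card J * superset_sum J u)"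
  proof (rule sum.mono_neutral_right)
    show "\<forall>J\<in>{J. J \<subseteq> C} - {C}. (- 1) ^ card J * superset_sum J u = 0"
    proof
      fix J assume J: "J \<in> {J. J \<subseteq> C} - {C}"
      then have "card J < m" using assms(3) fin by (auto intro!: psubset_card_mono)
      then show "(- 1) ^ card J * superset_sum J u = 0" using assms J by auto
    qed
  qed (use fin in auto)
  finally have "v (X - C) u = (- 1) ^ m * v C u"
    using assms by (simp add: superset_sum_full)
  moreover have "v (X - C) u = 0"
    using assms False card_X fin by (intro vanish) (auto simp: card_Diff_subset)
  ultimately show ?thesis by simp
qed

lemma dependency_superset_sum:
  assumes "\<forall>C. C \<subseteq> X \<and> card C = m \<longrightarrow> (\<Sum>u\<in>U. l u * v C u) = 0"
  shows "(\<Sum>u\<in>U. l u * superset_sum J u) = 0"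
proof -
  have "(\<Sum>u\<in>U. l u * superset_sum J u) =
      (\<Sum>C | C \<subseteq> X \<and> card C = m \<and> J \<subseteq> C. \<Sum>u\<in>U. l u * v C u)"
    unfolding superset_sum_def sum_distrib_left by (rule sum.swap)
  then show ?thesis using assms by simp
qed

section \<open>Alternating sums over \<open>m - p\<close> disjoint pairs\<close>

context
  fixes ps :: "('i \<times> 'i) list"
  assumes CHAR_le: "CHAR('a) \<le> m"
    and ps: "distinct (pair_points ps)" "set (pair_points ps) \<subseteq> X" "length ps = m - CHAR('a)"
begin

text \<open>If \<open>C\<close> is \<open>A\<close> with a transversal added, then \<open>u\<close>
  lies in \<open>X - C\<close>, so \<open>complement_relation\<close> expresses \<open>v C u\<close>
  by superset sums over subsets of \<open>C\<close>. Only the transversals themselves survive the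
  alternation, hence the value does not depend on \<open>A\<close>.\<close>

lemma swap_diff_v:
  assumes A: "A \<subseteq> X" "card A = CHAR('a)" "set (pair_points ps) \<inter> A = {}"
    and u: "u \<in> X" "u \<notin> A" "u \<notin> set (pair_points ps)"
  shows "swap_diff (\<lambda>C. v C u) ps A =
    - ((- 1) ^ (m + (m - CHAR('a)))) * swap_diff (\<lambda>J. superset_sum J u) ps {}"
proof -
  let ?e = "- ((- 1) ^ (m + (m - CHAR('a)))) :: 'a"
  note fin = finite_if_subset[OF A(1)]
  have "swap_diff (\<lambda>C. v C u) ps A =
      swap_diff (\<lambda>C. ?e * (\<Sum>J | J \<subseteq> C \<and> card J = m - CHAR('a). superset_sum J u)) ps A"
  proof (rule swap_diff_cong)
    fix C assume C: "A \<subseteq> C" "C \<subseteq> A \<union> set (pair_points ps)" "card C = card A + length ps"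
    then have C': "C \<subseteq> X" "card C = m" "u \<notin> C" using A u ps CHAR_le by auto
    have "v (X - C) u = 0"
      using C' u card_X finite_if_subset[OF C'(1)] by (intro vanish) (auto simp: card_Diff_subset)
    then have "(- 1) ^ m * v C u +
      (- 1) ^ (m - CHAR('a)) * (\<Sum>J | J \<subseteq> C \<and> card J = m - CHAR('a). superset_sum J u) = 0"
      using complement_relation[OF C'(1,2) u(1) CHAR_le] by simp
    then have "(- 1) ^ m * ((- 1) ^ m * v C u +
      (- 1) ^ (m - CHAR('a)) * (\<Sum>J | J \<subseteq> C \<and> card J = m - CHAR('a). superset_sum J u)) = 0" by simp
    then show "v C u = ?e * (\<Sum>J | J \<subseteq> C \<and> card J = m - CHAR('a). superset_sum J u)"
      by (simp add: distrib_left mult.assoc[symmetric] power_add[symmetric] mult_2[symmetric] add_eq_0_iff2)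
  qed (use A ps fin in auto)
  also have "\<dots> = ?e * (\<Sum>J | J \<subseteq> A \<and> card J + length ps = m - CHAR('a). swap_diff (\<lambda>J. superset_sum J u) ps J)"
    using A ps fin by (simp only: swap_diff_mult_left swap_diff_sum_subsets)
  also have "{J. J \<subseteq> A \<and> card J + length ps = m - CHAR('a)} = {{}}"
    using ps fin by (auto dest: finite_subset)
  finally show ?thesis by simp
qed

lemma card_complement_points: "card (X - set (pair_points ps)) = 2 * CHAR('a)"
  using ps CHAR_le card_X
  by (simp add: card_Diff_subset distinct_card length_pair_points)

lemma swap_diff_superset_sum_off_points:
  assumes u: "u \<in> X" "u \<notin> set (pair_points ps)"
  shows "swap_diff (\<lambda>J. superset_sum J u) ps {} = 0"
proof -
  let ?P = "set (pair_points ps)" and ?p = "CHAR('a)"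
  define s where "s u = swap_diff (\<lambda>J. superset_sum J u) ps {}" for u
  have CHAR: "2 \<le> ?p" using prime_CHAR prime_ge_2_nat by blast
  have fXP: "finite (X - ?P)" using finite_X by simp
  \<comment> \<open>There are \<open>2p\<close> points off the pairs, and
    \<open>m + 3 <= 2p\<close>.\<close>
  have "m + 1 \<le> card (X - ?P - {u})"
    using card_complement_points u fXP m_bound by (simp add: card_Diff_singleton)
  then obtain U' where U': "U' \<subseteq> X - ?P - {u}" "card U' = m + 1"
    by (rule obtain_subset_with_card_n)
  define U where "U = insert u U'"
  have fU': "finite U'" using U' fXP finite_subset by blast
  have U: "U \<subseteq> X - ?P" "card U = m + 2" "finite U" "u \<in> U"
    using U' u fU' by (auto simp: U_def card_insert_if)
  have UX: "U \<subseteq> X" using U(1) by auto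
  obtain l where l: "\<forall>w\<in>U. l w \<noteq> 0"
    "\<forall>C. C \<subseteq> X \<and> card C = m \<longrightarrow> (\<Sum>w\<in>U. l w * v C w) = 0"
    using dependency[OF UX U(2)] by metis
  \<comment> \<open>With \<open>A = U - B\<close> of size \<open>p\<close>, the dependency is
    alternated over \<open>A\<close> plus transversals. The points of \<open>A\<close> drop out by
    \<open>vanish\<close>, and at the points of \<open>B\<close> every value is \<open>s w\<close>
    times one common sign.\<close>
  have B: "(\<Sum>w\<in>B. l w * s w) = 0" if "B \<subseteq> U" "card B = m - ?p + 2" for B
  proof -
    define A where "A = U - B"
    have A: "A \<subseteq> X" "card A = ?p" "?P \<inter> A = {}" "A \<subseteq> U" "U - A = B" "finite A"
      using that U CHAR_le finite_subset[OF that(1)] by (auto simp: A_def card_Diff_subset)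
    have "0 = swap_diff (\<lambda>C. \<Sum>w\<in>U. l w * v C w) ps A"
    proof -
      have "swap_diff (\<lambda>C. \<Sum>w\<in>U. l w * v C w) ps A = swap_diff (\<lambda>_. 0) ps A"
        by (rule swap_diff_cong) (use A ps CHAR_le l(2) in \<open>auto intro!: l(2)[rule_format]\<close>)
      then show ?thesis by simp
    qed
    also have "\<dots> = (\<Sum>w\<in>U. l w * swap_diff (\<lambda>C. v C w) ps A)"
      by (simp add: swap_diff_sum swap_diff_mult_left)
    also have "\<dots> = (\<Sum>w\<in>B. l w * swap_diff (\<lambda>C. v C w) ps A)"
    proof (rule sum.mono_neutral_right)
      show "\<forall>w\<in>U - B. l w * swap_diff (\<lambda>C. v C w) ps A = 0"
      proof
        fix w assume "w \<in> U - B"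
        then have w: "w \<in> A" by (simp add: A_def)
        have "swap_diff (\<lambda>C. v C w) ps A = swap_diff (\<lambda>_. 0) ps A"
          by (rule swap_diff_cong) (use w A ps CHAR_le in \<open>auto intro!: vanish\<close>)
        then show "l w * swap_diff (\<lambda>C. v C w) ps A = 0" by simp
      qed
    qed (use U that in auto)
    also have "\<dots> = (\<Sum>w\<in>B. l w * (- ((- 1) ^ (m + (m - ?p))) * s w))"
    proof (rule sum.cong)
      fix w assume "w \<in> B"
      then show "l w * swap_diff (\<lambda>C. v C w) ps A = l w * (- ((- 1) ^ (m + (m - ?p))) * s w)"
        using swap_diff_v[OF A(1-3), of w] A U that by (auto simp: s_def)
    qed simp
    also have "\<dots> = - ((- 1) ^ (m + (m - ?p))) * (\<Sum>w\<in>B. l w * s w)"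
      unfolding sum_distrib_left by (rule sum.cong) (simp_all add: mult_ac)
    finally show ?thesis by simp
  qed
  \<comment> \<open>Exchanging \<open>u\<close> for \<open>w\<close> in a subset of size
    \<open>m - p + 2\<close> keeps the sum zero, so the two terms agree.\<close>
  have const: "l w * s w = l u * s u" if "w \<in> U" for w
  proof (cases "w = u")
    case False
    have "m - ?p + 1 \<le> card (U - {u, w})"
      using U that CHAR CHAR_le False by (subst card_Diff_subset) auto
    then obtain B' where B': "B' \<subseteq> U - {u, w}" "card B' = m - ?p + 1"
      by (rule obtain_subset_with_card_n)
    have fB': "finite B'" using B' U finite_subset by blast
    have "(\<Sum>w\<in>insert u B'. l w * s w) = 0" "(\<Sum>w\<in>insert w B'. l w * s w) = 0"
      using B' fB' U that by (auto intro!: B simp del: sum.insert) (auto simp: card_insert_if)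
    moreover have "u \<notin> B'" "w \<notin> B'" using B' by auto
    ultimately show ?thesis using fB' by (simp add: add_eq_0_iff2)
  qed simp
  have "m - ?p + 2 \<le> card U" using U by simp
  then obtain B' where B': "B' \<subseteq> U" "card B' = m - ?p + 2"
    by (rule obtain_subset_with_card_n)
  have "0 = (\<Sum>w\<in>B'. l w * s w)" using B[OF B'] by simp
  also have "\<dots> = (\<Sum>w\<in>B'. l u * s u)" using const B' by (intro sum.cong) auto
  also have "\<dots> = of_nat (m - ?p + 2) * (l u * s u)" using B' by simp
  finally have "of_nat (m - ?p + 2) * (l u * s u) = 0" by simp
  \<comment> \<open>\<open>m_bound\<close> gives \<open>m - p + 2 <= p - 1\<close>.\<close>
  moreover have "\<not> ?p dvd m - ?p + 2"
    by (rule not_CHAR_dvd) (use m_bound CHAR_le in auto)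
  then have "of_nat (m - ?p + 2) \<noteq> (0::'a)" by (simp only: of_nat_eq_0_iff_char_dvd simp_thms)
  ultimately have "s u = 0" using l(1) U by simp
  then show ?thesis by (simp add: s_def)
qed

text \<open>For \<open>u\<close> on a pair, a dependency between \<open>u\<close> and
  \<open>m + 1\<close> points off the pairs is used: the terms off the pairs vanish already, and the
  coefficient of \<open>u\<close> is nonzero.\<close>

lemma swap_diff_superset_sum:
  assumes u: "u \<in> X"
  shows "swap_diff (\<lambda>J. superset_sum J u) ps {} = 0"
proof (cases "u \<in> set (pair_points ps)")
  case True
  let ?P = "set (pair_points ps)"
  obtain U' where U': "U' \<subseteq> X - ?P" "card U' = m + 1"
    using obtain_subset_with_card_n[of "m + 1" "X - ?P"] card_complement_points m_bound by auto
  have fU': "finite U'" using U' finite_X finite_subset by blast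
  define U where "U = insert u U'"
  have U: "U \<subseteq> X" "card U = m + 2" using U' u True fU' by (auto simp: U_def card_insert_if)
  obtain l where l: "\<forall>w\<in>U. l w \<noteq> 0"
    "\<forall>C. C \<subseteq> X \<and> card C = m \<longrightarrow> (\<Sum>w\<in>U. l w * v C w) = 0"
    using dependency[OF U] by metis
  have "0 = swap_diff (\<lambda>J. \<Sum>w\<in>U. l w * superset_sum J w) ps {}"
    by (simp add: dependency_superset_sum[OF l(2)])
  also have "\<dots> = (\<Sum>w\<in>U. l w * swap_diff (\<lambda>J. superset_sum J w) ps {})"
    by (simp add: swap_diff_sum swap_diff_mult_left)
  also have "\<dots> = l u * swap_diff (\<lambda>J. superset_sum J u) ps {} +
      (\<Sum>w\<in>U'. l w * swap_diff (\<lambda>J. superset_sum J w) ps {})"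
    unfolding U_def using U' fU' True by (subst sum.insert) auto
  also have "(\<Sum>w\<in>U'. l w * swap_diff (\<lambda>J. superset_sum J w) ps {}) = 0"
    using U' by (intro sum.neutral) (auto simp: swap_diff_superset_sum_off_points)
  finally show ?thesis using l(1) by (simp add: U_def)
qed (use swap_diff_superset_sum_off_points u in blast)

end

text \<open>Points of \<open>J\<close> are traded for pairs while the total stays
  \<open>m - p\<close>. Taking \<open>(x, y)\<close> as a new pair shows that replacing
  \<open>x\<close> in \<open>J\<close> by \<open>y\<close> does not change the value; summing over
  all \<open>y\<close> shows that this common value is 0.\<close>

lemma swap_diff_superset_sum_general:
  assumes "CHAR('a) \<le> m" "distinct (pair_points ps)" "set (pair_points ps) \<subseteq> X"
    "J \<subseteq> X" "set (pair_points ps) \<inter> J = {}" "card J + length ps = m - CHAR('a)" "u \<in> X"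
  shows "swap_diff (\<lambda>J. superset_sum J u) ps J = 0"
  using assms(2-6)
proof (induction "card J" arbitrary: ps J)
  case 0
  then have "J = {}" using finite_if_subset by auto
  with 0 show ?case using swap_diff_superset_sum[of ps u] assms by auto
next
  case (Suc j)
  let ?P = "set (pair_points ps)"
  note fJ = finite_if_subset[OF Suc.prems(3)]
  obtain x J0 where J: "J = insert x J0" "x \<notin> J0" "card J0 = j"
    using Suc.hyps(2) by (metis card_Suc_eq)
  define h where "h y = swap_diff (\<lambda>J. superset_sum J u) ps (insert y J0)" for y
  have fJ0: "finite J0" using fJ J by simp
  have const: "h y = h x" if "y \<in> X - ?P - J0" for y
  proof (cases "y = x")
    case False
    have "swap_diff (\<lambda>J. superset_sum J u) ((x, y) # ps) J0 = 0"
      using Suc.prems Suc.hyps(2) J that False by (intro Suc.hyps(1)) auto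
    then show ?thesis by (simp add: h_def)
  qed simp
  have card0: "card J0 + length ps + 1 = m - CHAR('a)" using Suc J by simp
  \<comment> \<open>The sum over \<open>y\<close> leads to one-point extensions of sets of size
    \<open>m - p - 1\<close>. These add up to \<open>p + 1\<close> times a superset sum that is 0,
    as \<open>p\<close> does not divide \<open>p + 1\<close>.\<close>
  have "(\<Sum>y\<in>X - ?P - J0. h y) = swap_diff (\<lambda>J. \<Sum>y\<in>X - J. superset_sum (insert y J) u) ps J0"
    unfolding h_def using Suc.prems J finite_X by (intro sum_swap_diff_insert) auto
  also have "\<dots> = swap_diff (\<lambda>_. 0) ps J0"
  proof (rule swap_diff_cong)
    fix C assume C: "J0 \<subseteq> C" "C \<subseteq> J0 \<union> ?P" "card C = card J0 + length ps"
    have CX: "C \<subseteq> X" using C Suc.prems J by auto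
    have cC: "m - card C = CHAR('a) + 1" "card C < m" using card0 C by auto
    have "\<not> CHAR('a) dvd m - card C"
      unfolding cC(1) by (rule not_CHAR_dvd) (use prime_CHAR prime_ge_2_nat[of "CHAR('a)"] in auto)
    then have "superset_sum C u = 0" using CX cC assms by (intro superset_sum_eq_0) auto
    then show "(\<Sum>y\<in>X - C. superset_sum (insert y C) u) = 0"
      using sum_superset_sum_insert[of C u] CX cC by simp
  qed (use Suc.prems J fJ0 in auto)
  finally have "(\<Sum>y\<in>X - ?P - J0. h y) = 0" by simp
  moreover have "(\<Sum>y\<in>X - ?P - J0. h y) = (\<Sum>y\<in>X - ?P - J0. h x)"
    using const by (intro sum.cong) auto
  \<comment> \<open>The number of admissible \<open>y\<close> is \<open>2p + card J0 + 2\<close>,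
    and \<open>card J0 + 2 < p\<close>, so it is nonzero in the field.\<close>
  moreover have "card (X - ?P - J0) = 2 * m - 2 * length ps - card J0"
  proof -
    have "card (X - ?P) = 2 * m - 2 * length ps"
      using Suc.prems card_X finite_X by (simp add: card_Diff_subset distinct_card length_pair_points)
    then show ?thesis using Suc.prems J fJ0 by (subst card_Diff_subset) auto
  qed
  then have "card (X - ?P - J0) = 2 * CHAR('a) + (card J0 + 2)"
    using card0 assms(1) by linarith
  ultimately have "of_nat (2 * CHAR('a) + (card J0 + 2)) * h x = 0" by simp
  moreover have "\<not> CHAR('a) dvd card J0 + 2"
    by (rule not_CHAR_dvd) (use card0 m_bound in auto)
  then have "\<not> CHAR('a) dvd 2 * CHAR('a) + (card J0 + 2)"
    by (simp add: dvd_add_right_iff del: add_2_eq_Suc')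
  then have "of_nat (2 * CHAR('a) + (card J0 + 2)) \<noteq> (0::'a)"
    by (simp only: of_nat_eq_0_iff_char_dvd simp_thms)
  ultimately have "h x = 0" by (metis mult_eq_0_iff)
  then show ?case by (simp add: h_def J)
qed

text \<open>Without pairs, \<open>swap_diff_superset_sum_general\<close> treats the superset sums
  themselves for \<open>card J = m - p\<close>, the one size that double counting leaves
  open.\<close>

lemma v_eq_0:
  assumes "C \<subseteq> X" "card C = m" "u \<in> X"
  shows "v C u = 0"
proof (rule v_eq_0I)
  fix J u assume J: "J \<subseteq> X" "u \<in> X" "card J < m"
  show "superset_sum J u = 0"
  proof (cases "m - card J = CHAR('a)")
    case True
    then show ?thesis using swap_diff_superset_sum_general[of "[]" J u] J by auto
  next
    case False
    have "\<not> CHAR('a) dvd m - card J"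
      by (rule not_CHAR_dvd) (use J m_bound False in auto)
    then show ?thesis using J by (intro superset_sum_eq_0) auto
  qed
qed fact+

end

section \<open>Determinants of lists of rows\<close>

lemma basis_familyD:
  fixes L :: "'a::field vec list"
  assumes "basis_family k L"
  shows "length L = k" "set L \<subseteq> carrier_vec k" "det (mat_of_rows k L) \<noteq> 0"
proof -
  interpret vec_space "TYPE('a)" k .
  have b: "distinct L" "basis (set L)" using assms by (auto simp: basis_family_def)
  then show 1: "length L = k"
    using dim_basis[of "set L"] dim_is_n by (simp add: distinct_card)
  show 2: "set L \<subseteq> carrier_vec k" using b(2) by (auto simp: basis_def)
  let ?A = "mat_of_cols k L"
  have A: "?A \<in> carrier_mat k k" using 1 by auto
  have "rank ?A = k"
    using b 2 lin_indpt_full_rank[OF A] by (auto simp: basis_def)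
  then have "det ?A \<noteq> 0" using det_rank_iff[OF A] by simp
  then show "det (mat_of_rows k L) \<noteq> 0"
    using det_transpose[OF A] by (simp add: transpose_mat_of_cols)
qed

lemma basis_familyI:
  fixes L :: "'a::field vec list"
  assumes "length L = k" "set L \<subseteq> carrier_vec k" "det (mat_of_rows k L) \<noteq> 0"
  shows "basis_family k L"
proof -
  interpret vec_space "TYPE('a)" k .
  let ?A = "mat_of_cols k L"
  have A: "?A \<in> carrier_mat k k" using assms by auto
  have "det ?A \<noteq> 0"
    using det_transpose[OF A] assms by (simp add: transpose_mat_of_cols)
  then have rank: "rank ?A = k" using det_rank_iff[OF A] by simp
  have d: "distinct L"
    using non_distinct_low_rank[OF A] rank assms by force
  moreover have "lin_indpt (set L)"
    using full_rank_lin_indpt[OF A rank] d assms by simp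
  then have "basis (set L)"
    using d assms by (intro dim_li_is_basis) (auto simp: distinct_card dim_is_n)
  ultimately show ?thesis by (simp add: basis_family_def)
qed

lemma det_rows_swap_adjacent:
  fixes x y :: "'a::field vec"
  assumes "length (ws @ x # y # zs) = k"
  shows "det (mat_of_rows k (ws @ x # y # zs)) = - det (mat_of_rows k (ws @ y # x # zs))"
proof -
  let ?B = "mat_of_rows k (ws @ y # x # zs)"
  have "mat_of_rows k (ws @ x # y # zs) = swaprows (length ws) (Suc (length ws)) ?B"
  proof (rule eq_matI)
    fix i j
    assume "i < dim_row (swaprows (length ws) (Suc (length ws)) ?B)"
      "j < dim_col (swaprows (length ws) (Suc (length ws)) ?B)"
    then have ij: "i < k" "j < k" using assms by auto
    consider "i < length ws" | "i = length ws" | "i = Suc (length ws)" | "i > Suc (length ws)" by linarith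
    then show "mat_of_rows k (ws @ x # y # zs) $$ (i, j) = swaprows (length ws) (Suc (length ws)) ?B $$ (i, j)"
      using ij assms by cases (auto simp: mat_of_rows_index nth_append nth_Cons split: nat.splits)
  qed auto
  then show ?thesis
    using assms det_swaprows[of "length ws" k "Suc (length ws)" ?B] by (simp add: carrier_matI)
qed

lemma det_rows_move:
  fixes x :: "'a::field vec"
  assumes "length (ws @ ys @ x # zs) = k"
  shows "det (mat_of_rows k (ws @ ys @ x # zs)) = (- 1) ^ length ys * det (mat_of_rows k (ws @ x # ys @ zs))"
  using assms
proof (induction ys arbitrary: ws)
  case (Cons y ys)
  have "det (mat_of_rows k (ws @ (y # ys) @ x # zs)) = (- 1) ^ length ys * det (mat_of_rows k (ws @ y # x # ys @ zs))"
    using Cons.IH[of "ws @ [y]"] Cons.prems by simp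
  also have "det (mat_of_rows k (ws @ y # x # ys @ zs)) = - det (mat_of_rows k (ws @ x # y # ys @ zs))"
    by (rule det_rows_swap_adjacent) (use Cons.prems in simp)
  finally show ?case by simp
qed simp

lemma nths_insert:
  assumes "x < length G" "x \<notin> A"
  shows "\<exists>ys zs. nths G (insert x A) = ys @ G ! x # zs \<and> nths G A = ys @ zs"
proof -
  have G: "G = take x G @ G ! x # drop (Suc x) G" using assms by (simp add: id_take_nth_drop)
  have len: "length (take x G) = x" using assms by simp
  let ?ys = "nths (take x G) A" and ?zs = "nths (drop (Suc x) G) {j. Suc (j + x) \<in> A}"
  have "nths G A = ?ys @ ?zs"
    by (subst G) (use assms in \<open>simp add: nths_append nths_Cons\<close>)
  moreover have "nths (take x G) (insert x A) = ?ys"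
    unfolding nths_def by (intro arg_cong[where f = "map fst"] filter_cong) (auto simp: set_zip)
  then have "nths G (insert x A) = ?ys @ G ! x # ?zs"
    by (subst G) (use assms in \<open>simp add: nths_append nths_Cons\<close>)
  ultimately show ?thesis by blast
qed

lemma length_nths_subset: "C \<subseteq> {..<length G} \<Longrightarrow> length (nths G C) = card C"
  unfolding length_nths by (rule arg_cong[where f = card]) auto

section \<open>Linear dependencies, row rank and change of basis\<close>

lemma det_rows_linear:
  fixes L :: "'a::field vec list"
  assumes "Suc (length L) = k"
  shows "\<exists>f. \<forall>u. det (mat_of_rows k (u # L)) = (\<Sum>j<k. u $ j * f j)"
proof -
  let ?M = "\<lambda>u. mat_of_rows k (u # L)"
  \<comment> \<open>Cofactors along the first row ignore that row, so \<open>0\<^sub>v k\<close> can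
    stand in for \<open>u\<close>.\<close>
  have "det (?M u) = (\<Sum>j<k. u $ j * cofactor (?M (0\<^sub>v k)) 0 j)" for u
  proof -
    have M: "?M u \<in> carrier_mat k k" for u using assms by auto
    have del: "mat_delete (?M u) 0 j = mat_delete (?M (0\<^sub>v k)) 0 j" for j
      unfolding mat_delete_def by (rule cong_mat) (auto simp: mat_of_rows_index)
    have "det (?M u) = (\<Sum>j<k. ?M u $$ (0, j) * cofactor (?M u) 0 j)"
      using laplace_expansion_row[OF M] assms by auto
    also have "\<dots> = (\<Sum>j<k. u $ j * cofactor (?M (0\<^sub>v k)) 0 j)"
      using assms by (intro sum.cong) (auto simp: cofactor_def del mat_of_rows_index)
    finally show ?thesis .
  qed
  then show ?thesis by blast
qed

text \<open>The coordinate matrix is padded with zero rows to a square one. As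
  \<open>k < card U\<close> there is such a row, so the matrix is singular and a kernel vector
  supplies \<open>l\<close>.\<close>

lemma vectors_dependent:
  fixes g :: "'i \<Rightarrow> 'a::field vec"
  assumes "finite U" "k < card U" 
  shows "\<exists>l. (\<exists>u\<in>U. l u \<noteq> 0) \<and> (\<forall>j<k. (\<Sum>u\<in>U. l u * g u $ j) = 0)"
proof -
  obtain us where us: "set us = U" "distinct us" using assms(1) finite_distinct_list by blast
  define n where "n = length us"
  have n: "n = card U" using us distinct_card n_def by metis
  define M where "M = mat n n (\<lambda>(i, j). if i < k then g (us ! j) $ i else 0)"
  have M: "M \<in> carrier_mat n n" by (simp add: M_def)
  have "row M k = 0\<^sub>v n" using n assms by (intro eq_vecI) (auto simp: M_def)
  then have "det M = 0"
    using laplace_expansion_row[OF M, of k] n assms by (simp add: M_def)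
  then obtain c where c: "c \<in> carrier_vec n" "c \<noteq> 0\<^sub>v n" "M *\<^sub>v c = 0\<^sub>v n"
    using det_0_iff_vec_prod_zero[OF M] by blast
  define l where "l u = c $ (THE i. i < n \<and> us ! i = u)" for u
  have l: "l (us ! i) = c $ i" if "i < n" for i
    unfolding l_def using that us(2)
    by (intro arg_cong[where f = "($) c"] the_equality) (auto simp: n_def nth_eq_iff_index_eq)
  obtain i where "i < n" "c $ i \<noteq> 0"
    using c(1,2) by (metis carrier_vecD eq_vecI index_zero_vec(1) index_zero_vec(2))
  then have "\<exists>u\<in>U. l u \<noteq> 0" using l[of i] us by (auto simp: n_def intro!: bexI[of _ "us ! i"])
  moreover have "(\<Sum>u\<in>U. l u * g u $ j) = 0" if "j < k" for j
  proof -
    have "0 = (M *\<^sub>v c) $ j" using c(3) that assms n by simp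
    also have "\<dots> = (\<Sum>i<n. c $ i * g (us ! i) $ j)"
      using that assms n c(1) M by (auto simp: scalar_prod_def M_def atLeast0LessThan mult.commute intro!: sum.cong)
    also have "\<dots> = (\<Sum>i<n. l (us ! i) * g (us ! i) $ j)" using l by simp
    also have "\<dots> = (\<Sum>u\<in>U. l u * g u $ j)"
      by (rule sum.reindex_bij_betw) (use us bij_betw_nth[of us "{..<n}" U] n_def in auto)
    finally show ?thesis by simp
  qed
  ultimately show ?thesis by blast
qed

text \<open>A maximal independent set \<open>S\<close> of fewer than \<open>n\<close> columns
  imposes fewer than \<open>n\<close> conditions on \<open>l\<close>, so a nonzero solution exists;
  by linearity it is a relation for all columns.\<close>

lemma full_row_rankI:
  fixes M :: "'a::field mat"
  assumes "\<And>l. (\<And>j. j < dim_col M \<Longrightarrow> (\<Sum>i<dim_row M. l i * M $$ (i, j)) = 0) \<Longrightarrow> \<forall>i<dim_row M. l i = 0"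
  shows "full_row_rank M"
proof -
  define n where "n = dim_row M"
  interpret vec_space "TYPE('a)" n .
  have M: "M \<in> carrier_mat n (dim_col M)" unfolding n_def by (rule carrier_matI) auto
  have cols: "set (cols M) \<subseteq> carrier_vec n" using M cols_dim by blast
  obtain S where S: "maximal S (\<lambda>T. T \<subseteq> set (cols M) \<and> lin_indpt T)" "finite S"
    using maximal_exists_superset[of "set (cols M)" "\<lambda>T. T \<subseteq> set (cols M) \<and> lin_indpt T" "{}"]
      finite_lin_indpt2[of "{}"] by auto
  have rank: "rank M = card S" by (rule rank_card_indpt[OF M S(1)])
  have S': "S \<subseteq> set (cols M)" "lin_indpt S" using S(1) by (auto simp: maximal_def)
  have Sc: "S \<subseteq> carrier_vec n" using S' cols by auto
  have le: "card S \<le> n" using li_le_dim(2)[of S] S' Sc dim_is_n by auto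
  have "card S = n"
  proof (rule ccontr)
    assume "card S \<noteq> n"
    then have lt: "card S < card {..<n}" using le by simp
    obtain xs where xs: "set xs = S" "distinct xs" using S(2) finite_distinct_list by blast
    have lxs: "length xs = card S" using xs distinct_card by metis
    obtain l where l: "\<exists>i\<in>{..<n}. l i \<noteq> 0"
      "\<forall>j<card S. (\<Sum>i\<in>{..<n}. l i * vec (card S) (\<lambda>j. xs ! j $ i) $ j) = 0"
      using vectors_dependent[OF _ lt, of "\<lambda>i. vec (card S) (\<lambda>j. xs ! j $ i)"] by auto
    have S0: "(\<Sum>i<n. l i * x $ i) = 0" if x: "x \<in> S" for x :: "'a vec"
    proof -
      obtain j where "j < card S" "x = xs ! j" using x xs lxs by (metis in_set_conv_nth)
      then show ?thesis using l(2) by simp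
    qed
    have col0: "(\<Sum>i<n. l i * c $ i) = 0" if c: "c \<in> set (cols M)" for c :: "'a vec"
    proof (cases "c \<in> S")
      case False
      have cc: "c \<in> carrier_vec n" using c cols by auto
      have "\<not> lin_indpt (S \<union> {c})"
        using S(1) False c S'(1) unfolding maximal_def by (metis Un_insert_right Un_upper1 insertI1 insert_subset sup_bot_right)
      then have "c \<in> span S" using lin_dep_iff_in_span[of S c] False cc Sc S' by auto
      then obtain a A where A: "finite A" "A \<subseteq> S" "c = lincomb a A"
        unfolding span_def by auto
      have "(\<Sum>i<n. l i * c $ i) = (\<Sum>i<n. \<Sum>x\<in>A. a x * (l i * x $ i))"
        using A Sc by (auto simp: lincomb_index sum_distrib_left mult_ac intro!: sum.cong)
      also have "\<dots> = (\<Sum>x\<in>A. a x * (\<Sum>i<n. l i * x $ i))"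
        by (subst sum.swap) (simp add: sum_distrib_left)
      also have "\<dots> = 0" using S0 A by (intro sum.neutral) auto
      finally show ?thesis .
    qed (use S0 in auto)
    have "(\<Sum>i<n. l i * M $$ (i, j)) = 0" if j: "j < dim_col M" for j
    proof -
      have "(\<Sum>i<n. l i * M $$ (i, j)) = (\<Sum>i<n. l i * col M j $ i)"
        using j by (intro sum.cong) (auto simp: n_def)
      also have "\<dots> = 0" by (rule col0) (use j in \<open>auto simp: cols_def\<close>)
      finally show ?thesis .
    qed
    then have "\<forall>i<n. l i = 0" using assms[of l] unfolding n_def by blast
    then show False using l(1) by auto
  qed
  then show ?thesis using rank by (simp add: full_row_rank_def n_def)
qed

text \<open>Passing to coordinates applies the inverse \<open>N\<close> of the matrix of
  \<open>B\<close> to every row, so \<open>c = det N\<close>. The choice of basis thus only rescales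
  the arc matrix.\<close>

lemma det_wrt_eq:
  fixes B :: "'a::field vec list"
  assumes "basis_family k B"
  shows "\<exists>c. c \<noteq> 0 \<and> (\<forall>u C. u \<in> carrier_vec k \<longrightarrow> set C \<subseteq> carrier_vec k \<longrightarrow> Suc (length C) = k \<longrightarrow>
    det_wrt k B u C = c * det (mat_of_rows k (u # C)))"
proof -
  note B = basis_familyD[OF assms]
  let ?M = "mat_of_cols k B"
  have M: "?M \<in> carrier_mat k k" using B(1) by auto
  have dM: "det ?M \<noteq> 0" using B(3) det_transpose[OF M] by (simp add: transpose_mat_of_cols)
  obtain N where N: "N \<in> carrier_mat k k" "N * ?M = 1\<^sub>m k" "?M * N = 1\<^sub>m k"
    using det_non_zero_imp_unit[OF M dM, of "()"] by (auto simp: Units_def ring_mat_def)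
  have coords: "coords k B u = N *\<^sub>v u" if u: "u \<in> carrier_vec k" for u
    unfolding coords_def
  proof (rule the_equality)
    show "N *\<^sub>v u \<in> carrier_vec k \<and> ?M *\<^sub>v (N *\<^sub>v u) = u"
      using N M u by (metis assoc_mult_mat_vec mult_mat_vec_carrier one_mult_mat_vec)
    fix c assume "c \<in> carrier_vec k \<and> ?M *\<^sub>v c = u"
    then show "c = N *\<^sub>v u" using N M by (metis assoc_mult_mat_vec one_mult_mat_vec)
  qed
  have "det N \<noteq> 0" using det_mult[OF N(1) M] N by auto
  moreover have "det_wrt k B u C = det N * det (mat_of_rows k (u # C))"
    if u: "u \<in> carrier_vec k" and C: "set C \<subseteq> carrier_vec k" "Suc (length C) = k" for u C
  proof -
    let ?R = "mat_of_rows k (u # C)"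
    have R: "?R \<in> carrier_mat k k" using C by auto
    have mem: "(u # C) ! i \<in> carrier_vec k" if "i < k" for i
      using that u C by (cases i) auto
    have "mat_of_rows k (map (coords k B) (u # C)) = ?R * N\<^sup>T"
    proof (rule eq_matI)
      fix i j assume "i < dim_row (?R * N\<^sup>T)" "j < dim_col (?R * N\<^sup>T)"
      then have ij: "i < k" "j < k" using C N by auto
      have "mat_of_rows k (map (coords k B) (u # C)) $$ (i, j) = (N *\<^sub>v ((u # C) ! i)) $ j"
        using ij C coords[OF mem[OF ij(1)]] by (simp add: mat_of_rows_index del: list.map nth_Cons_0 nth_Cons_Suc) 
      also have "\<dots> = row N j \<bullet> ((u # C) ! i)" using ij N by auto
      also have "\<dots> = ((u # C) ! i) \<bullet> row N j"
        using ij N mem by (intro comm_scalar_prod[of _ k]) auto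
      also have "\<dots> = (?R * N\<^sup>T) $$ (i, j)"
        using ij N C mem[OF ij(1)] by (subst index_mult_mat) auto
      finally show "mat_of_rows k (map (coords k B) (u # C)) $$ (i, j) = (?R * N\<^sup>T) $$ (i, j)" .
    qed (use C N in auto)
    then show ?thesis
      unfolding det_wrt_def using det_mult[OF R, of "N\<^sup>T"] N det_transpose[OF N(1)] by simp
  qed
  ultimately show ?thesis by blast
qed

section \<open>Arcs\<close>

definition arc_det :: "nat \<Rightarrow> 'a::field vec list \<Rightarrow> nat \<Rightarrow> nat set \<Rightarrow> 'a" where
  "arc_det k G u C = det (mat_of_rows k (G ! u # nths G C))"

locale arc =
  fixes k :: nat and G :: "'a::field vec list"
  assumes is_arc: "is_arc k G" and k_ge_2: "2 \<le> k"
begin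

lemma nth_carrier: "u < length G \<Longrightarrow> G ! u \<in> carrier_vec k"
  using is_arc nth_mem unfolding is_arc_def by blast

lemma arc_det_eq_0:
  assumes "C \<subseteq> {..<length G}" "Suc (card C) = k" "u \<in> C"
  shows "arc_det k G u C = 0"
proof -
  have C: "C = insert u (C - {u})" using assms by auto
  have u: "u < length G" using assms by auto
  obtain ys zs where yz: "nths G C = ys @ G ! u # zs"
    using nths_insert[of u G "C - {u}"] u C by auto
  have len: "length (G ! u # ys @ G ! u # zs) = k"
    using length_nths_subset[OF assms(1)] assms(2) yz by simp
  show ?thesis
    unfolding arc_det_def yz
    by (rule det_identical_rows[of _ k 0 "Suc (length ys)"])
      (use len u in \<open>auto intro!: eq_vecI carrier_matI simp: mat_of_rows_index nth_append\<close>)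
qed

lemma arc_det_neq_0:
  assumes "C \<subseteq> {..<length G}" "Suc (card C) = k" "u < length G" "u \<notin> C"
  shows "arc_det k G u C \<noteq> 0"
proof -
  obtain ys zs where yz: "nths G (insert u C) = ys @ G ! u # zs" "nths G C = ys @ zs"
    using nths_insert[OF assms(3,4)] by blast
  have "finite C" using assms(1) finite_subset by blast
  then have "card (insert u C) = k" using assms by simp
  then have "basis_family k (nths G (insert u C))"
    using is_arc assms by (auto simp: is_arc_def)
  from basis_familyD[OF this] show ?thesis
    using det_rows_move[of "[]" ys "G ! u" zs k] by (auto simp: arc_det_def yz)
qed

text \<open>If \<open>l b = 0\<close> and \<open>l a \<noteq> 0\<close>, evaluating the relation at
  the rows from \<open>U - {a, b}\<close> leaves only the term of \<open>a\<close>, whose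
  determinant is nonzero in an arc.\<close>

lemma arc_det_dependency:
  assumes U: "U \<subseteq> {..<length G}" "card U = Suc k"
  shows "\<exists>l. (\<forall>u\<in>U. l u \<noteq> 0) \<and>
    (\<forall>L. Suc (length L) = k \<longrightarrow> (\<Sum>u\<in>U. l u * det (mat_of_rows k (G ! u # L))) = 0)"
proof -
  have fin: "finite U" using U finite_subset by blast
  obtain l where l: "\<exists>u\<in>U. l u \<noteq> 0" "\<forall>j<k. (\<Sum>u\<in>U. l u * G ! u $ j) = 0"
    using vectors_dependent[OF fin, of k "\<lambda>u. G ! u"] U by auto
  have lin: "(\<Sum>u\<in>U. l u * det (mat_of_rows k (G ! u # L))) = 0" if L: "Suc (length L) = k" for L
  proof -
    obtain f where f: "\<And>u. det (mat_of_rows k (u # L)) = (\<Sum>j<k. u $ j * f j)"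
      using det_rows_linear[OF L] by blast
    have "(\<Sum>u\<in>U. l u * det (mat_of_rows k (G ! u # L))) = (\<Sum>j<k. f j * (\<Sum>u\<in>U. l u * G ! u $ j))"
      unfolding f sum_distrib_left by (subst sum.swap) (simp add: mult_ac)
    then show ?thesis using l(2) by simp
  qed
  have "l b \<noteq> 0" if b: "b \<in> U" for b
  proof
    assume lb: "l b = 0"
    obtain a where a: "a \<in> U" "l a \<noteq> 0" using l(1) by auto
    define C where "C = U - {a, b}"
    have ab: "a \<noteq> b" using a lb by auto
    have C: "C \<subseteq> {..<length G}" "Suc (card C) = k"
      using U a b ab fin k_ge_2 by (auto simp: C_def card_Diff_subset)
    have "0 = (\<Sum>u\<in>U. l u * arc_det k G u C)"
      using lin[of "nths G C"] C by (simp add: arc_det_def length_nths_subset)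
    also have "\<dots> = (\<Sum>u\<in>{a}. l u * arc_det k G u C)"
      using a fin lb by (intro sum.mono_neutral_right) (auto simp: C_def intro!: arc_det_eq_0[OF C, unfolded C_def])
    finally have "arc_det k G a C = 0" using a by simp
    moreover have "arc_det k G a C \<noteq> 0"
      using a U C by (intro arc_det_neq_0) (auto simp: C_def)
    ultimately show False by simp
  qed
  then show ?thesis using lin by blast
qed

text \<open>Columns of the matrix exist only for \<open>u\<close> outside \<open>A\<close>; for
  \<open>u\<close> in \<open>A\<close> every determinant has a repeated row. \<open>X\<close> may be
  part of a larger arc, as the bound on arc sizes requires.\<close>

lemma cancelling_systemI:
  assumes "prime CHAR('a)" "k \<le> 2 * CHAR('a) - 2"
    and X: "X \<subseteq> {..<length G}" "card X + 2 = 2 * k"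
    and cancel: "\<And>A u. A \<subseteq> X \<Longrightarrow> card A + 2 = k \<Longrightarrow> u \<in> X - A \<Longrightarrow>
      (\<Sum>x\<in>X - A. \<beta> (insert x A) * arc_det k G u (insert x A)) = 0"
  shows "cancelling_system X (k - 1) (\<lambda>C u. \<beta> C * arc_det k G u C)"
proof
  show finX: "finite X" using X finite_subset by blast
  show "card X = 2 * (k - 1)" using X k_ge_2 by simp
  show "prime CHAR('a)" by fact
  show "k - 1 + 3 \<le> 2 * CHAR('a)" using assms(2) k_ge_2 by simp
  fix C u assume "C \<subseteq> X" "card C = k - 1" "u \<in> C"
  then show "\<beta> C * arc_det k G u C = 0" using X k_ge_2 arc_det_eq_0[of C u] by auto
next
  fix U assume "U \<subseteq> X" "card U = k - 1 + 2"
  then have "U \<subseteq> {..<length G}" "card U = Suc k" using X k_ge_2 by auto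
  then obtain l where l: "\<forall>u\<in>U. l u \<noteq> 0"
    "\<forall>L. Suc (length L) = k \<longrightarrow> (\<Sum>u\<in>U. l u * det (mat_of_rows k (G ! u # L))) = 0"
    using arc_det_dependency by blast
  show "\<exists>l. (\<forall>u\<in>U. l u \<noteq> 0) \<and>
      (\<forall>C. C \<subseteq> X \<and> card C = k - 1 \<longrightarrow> (\<Sum>u\<in>U. l u * (\<beta> C * arc_det k G u C)) = 0)"
  proof (intro exI[of _ l] conjI allI impI)
    fix C assume C: "C \<subseteq> X \<and> card C = k - 1"
    then have "Suc (length (nths G C)) = k" using k_ge_2 X length_nths_subset[of C G] by auto
    then have "(\<Sum>u\<in>U. l u * arc_det k G u C) = 0"
      using l(2) by (simp add: arc_det_def)
    then have "\<beta> C * (\<Sum>u\<in>U. l u * arc_det k G u C) = 0" by simp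
    then show "(\<Sum>u\<in>U. l u * (\<beta> C * arc_det k G u C)) = 0"
      by (simp add: sum_distrib_left mult_ac)
  qed (use l(1) in auto)
next
  fix A u assume A: "A \<subseteq> X" "Suc (card A) = k - 1" and u: "u \<in> X"
  have fA: "finite A" using finite_subset[OF A(1)] X finite_subset by auto
  show "(\<Sum>x\<in>X - A. \<beta> (insert x A) * arc_det k G u (insert x A)) = 0"
  proof (cases "u \<in> A")
    case True
    have "arc_det k G u (insert x A) = 0" if "x \<in> X - A" for x
      using A X True that fA by (intro arc_det_eq_0) auto
    then show ?thesis by simp
  qed (use cancel A u in auto)
qed

end

text \<open>A row relation, reindexed by subsets as \<open>\<beta>\<close>, forms a cancelling
  system, so \<open>\<beta> C * arc_det k G u C\<close> is always 0. A point \<open>u\<close>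
  outside \<open>C\<close> makes the determinant nonzero.\<close>

theorem full_row_rank_arc_matrix:
  fixes G :: "'a::field vec list"
  assumes char: "prime CHAR('a)" "k \<le> 2 * CHAR('a) - 2"
    and G: "is_arc k G" "length G + 2 = 2 * k" and B: "basis_family k B"
  shows "full_row_rank (arc_matrix k B G)"
proof -
  define n where "n = length G"
  \<comment> \<open>\<open>k <= length G = 2k - 2\<close> forces this.\<close>
  have k2: "2 \<le> k" using G by (auto simp: is_arc_def)
  interpret arc k G using G k2 by unfold_locales
  obtain c where c: "c \<noteq> 0" "\<And>u C. u \<in> carrier_vec k \<Longrightarrow> set C \<subseteq> carrier_vec k \<Longrightarrow> Suc (length C) = k \<Longrightarrow>
    det_wrt k B u C = c * det (mat_of_rows k (u # C))"
    using det_wrt_eq[OF B] by blast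
  have dw: "det_wrt k B (G ! u) (nths G C) = c * arc_det k G u C"
    if "u < n" "C \<subseteq> {..<n}" "card C = k - 1" for u C
  proof -
    have "set (nths G C) \<subseteq> carrier_vec k"
      using set_nths_subset[of G C] is_arc by (auto simp: is_arc_def)
    then show ?thesis
      unfolding arc_det_def using that nth_carrier k2 by (intro c(2)) (auto simp: n_def length_nths_subset)
  qed
  let ?M = "arc_matrix k B G"
  define rs where "rs = arc_row_index k n"
  define cs where "cs = arc_col_index k n"
  have dims: "dim_row ?M = length rs" "dim_col ?M = length cs"
    by (simp_all add: arc_matrix_def Let_def rs_def cs_def n_def)
  have rs: "set rs = {C. C \<subseteq> {..<n} \<and> card C = k - 1}" "distinct rs"
    by (simp_all add: rs_def set_arc_row_index distinct_arc_row_index)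
  show ?thesis
  proof (rule full_row_rankI)
    fix l assume l: "\<And>j. j < dim_col ?M \<Longrightarrow> (\<Sum>i<dim_row ?M. l i * ?M $$ (i, j)) = 0"
    define \<beta> where "\<beta> C = l (THE i. i < length rs \<and> rs ! i = C)" for C
    have \<beta>: "\<beta> (rs ! i) = l i" if "i < length rs" for i
      unfolding \<beta>_def using that rs(2)
      by (intro arg_cong[where f = l] the_equality) (auto simp: nth_eq_iff_index_eq)
    have "cancelling_system {..<n} (k - 1) (\<lambda>C u. \<beta> C * arc_det k G u C)"
    proof (rule cancelling_systemI)
      fix A u assume A: "A \<subseteq> {..<n}" "card A + 2 = k" and u: "u \<in> {..<n} - A"
      have fA: "finite A" using A finite_subset by blast
      have "(u, A) \<in> set cs" using A u by (auto simp: cs_def set_arc_col_index)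
      then obtain j where j: "j < length cs" "cs ! j = (u, A)" by (metis in_set_conv_nth)
      have "0 = (\<Sum>i<length rs. l i * ?M $$ (i, j))" using l j dims by simp
      also have "\<dots> = (\<Sum>i<length rs. (\<lambda>C. \<beta> C * (if A \<subseteq> C \<and> C \<subseteq> {..<n} - {u} then det_wrt k B (G ! u) (nths G C) else 0)) (rs ! i))"
        using j \<beta> by (intro sum.cong) (auto simp: arc_matrix_def Let_def rs_def[symmetric] cs_def[symmetric] n_def[symmetric])
      also have "\<dots> = (\<Sum>C\<in>set rs. \<beta> C * (if A \<subseteq> C \<and> C \<subseteq> {..<n} - {u} then det_wrt k B (G ! u) (nths G C) else 0))"
        by (rule sum.reindex_bij_betw) (use rs(2) bij_betw_nth[of rs "{..<length rs}" "set rs"] in auto)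
      \<comment> \<open>The row indices containing \<open>A\<close> are the sets
        \<open>insert x A\<close>. If \<open>u\<close> lies in one of them, the zero entry agrees
        with the determinant, which has a repeated row.\<close>
      also have "\<dots> = (\<Sum>C\<in>(\<lambda>x. insert x A) ` ({..<n} - A). c * (\<beta> C * arc_det k G u C))"
      proof (rule sum.mono_neutral_cong_right)
        show sub: "(\<lambda>x. insert x A) ` ({..<n} - A) \<subseteq> set rs"
          using A fA by (auto simp: rs(1))
        fix C assume "C \<in> (\<lambda>x. insert x A) ` ({..<n} - A)"
        then have C: "C \<subseteq> {..<n}" "card C = k - 1" "A \<subseteq> C" using sub rs(1) by auto
        show "\<beta> C * (if A \<subseteq> C \<and> C \<subseteq> {..<n} - {u} then det_wrt k B (G ! u) (nths G C) else 0) =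
          c * (\<beta> C * arc_det k G u C)"
        proof (cases "u \<in> C")
          case True
          then have "arc_det k G u C = 0" using C k2 by (intro arc_det_eq_0) (auto simp: n_def)
          then show ?thesis using True by auto
        next
          case False
          then have "C \<subseteq> {..<n} - {u}" using C by auto
          then show ?thesis using C u dw by simp
        qed
      next
        show "\<forall>C\<in>set rs - (\<lambda>x. insert x A) ` ({..<n} - A).
            \<beta> C * (if A \<subseteq> C \<and> C \<subseteq> {..<n} - {u} then det_wrt k B (G ! u) (nths G C) else 0) = 0"
        proof
          fix C assume C: "C \<in> set rs - (\<lambda>x. insert x A) ` ({..<n} - A)"
          have "\<not> A \<subseteq> C"
          proof
            assume "A \<subseteq> C"
            moreover have fC: "finite C" using C rs(1) finite_subset by auto
            moreover have "card C = Suc (card A)" using C rs(1) A by auto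
            ultimately have "card (C - A) = 1" using fA by (simp add: card_Diff_subset)
            then obtain x where "C - A = {x}" by (rule card_1_singletonE)
            then have "C = insert x A" "x \<in> {..<n} - A" using \<open>A \<subseteq> C\<close> C rs(1) by auto
            then show False using C by auto
          qed
          then show "\<beta> C * (if A \<subseteq> C \<and> C \<subseteq> {..<n} - {u} then det_wrt k B (G ! u) (nths G C) else 0) = 0" by simp
        qed
      qed simp
      also have "\<dots> = (\<Sum>x\<in>{..<n} - A. c * (\<beta> (insert x A) * arc_det k G u (insert x A)))"
        by (subst sum.reindex) (auto intro!: inj_onI)
      also have "\<dots> = c * (\<Sum>x\<in>{..<n} - A. \<beta> (insert x A) * arc_det k G u (insert x A))"
        by (simp add: sum_distrib_left)
      finally show "(\<Sum>x\<in>{..<n} - A. \<beta> (insert x A) * arc_det k G u (insert x A)) = 0"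
        using c(1) by simp
    qed (use char G in \<open>auto simp: n_def\<close>)
    then interpret cancelling_system "{..<n}" "k - 1" "\<lambda>C u. \<beta> C * arc_det k G u C" .
    show "\<forall>i<dim_row ?M. l i = 0"
    proof (intro allI impI)
      fix i assume "i < dim_row ?M"
      then have i: "i < length rs" using dims by simp
      then have C: "rs ! i \<subseteq> {..<n}" "card (rs ! i) = k - 1" using rs(1) nth_mem by auto
      have "card (rs ! i) < card {..<n}" using C G k2 by (simp add: n_def)
      then obtain u where u: "u < n" "u \<notin> rs ! i"
        using C by (metis card_mono finite_lessThan lessThan_iff not_less subsetI finite_subset)
      have "\<beta> (rs ! i) * arc_det k G u (rs ! i) = 0"
        using v_eq_0[OF C] u by simp
      moreover have "arc_det k G u (rs ! i) \<noteq> 0"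
        using C u k2 by (intro arc_det_neq_0) (auto simp: n_def)
      ultimately show "l i = 0" using \<beta>[OF i] by simp
    qed
  qed
qed

section \<open>Arcs over finite fields\<close>

lemma coeff_prod_linear:
  fixes s :: "'i \<Rightarrow> 'a::field"
  assumes "finite J"
  shows "degree (\<Prod>z\<in>J. [:s z, - 1:]) \<le> card J \<and> coeff (\<Prod>z\<in>J. [:s z, - 1:]) (card J) = (- 1) ^ card J"
  using assms
proof (induction J rule: finite_induct)
  case (insert x J)
  let ?P = "\<Prod>z\<in>J. [:s z, - 1:]"
  have "degree ([:s x, - 1:] * ?P) \<le> degree [:s x, - 1:] + degree ?P" by (rule degree_mult_le)
  then have "degree ([:s x, - 1:] * ?P) \<le> Suc (card J)" using insert by simp
  moreover have "coeff ([:s x, - 1:] * ?P) (Suc (card J)) = (- 1) ^ Suc (card J)"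
    using insert coeff_eq_0[of ?P "Suc (card J)"] by (simp add: le_imp_less_Suc)
  ultimately show ?case using insert by simp
qed simp

text \<open>\<open>Q\<close> is the Lagrange interpolation polynomial of \<open>P\<close> and equals
  \<open>P\<close> by the degree bounds. Up to sign the sum is the coefficient of \<open>Q\<close>
  of degree \<open>card I - 1\<close>, which exceeds the degree of \<open>P\<close>.\<close>

lemma divided_difference_eq_0:
  fixes P :: "'a::field poly"
  assumes fin: "finite I" and inj: "inj_on s I" and deg: "degree P + 1 < card I"
  shows "(\<Sum>x\<in>I. poly P (s x) / (\<Prod>z\<in>I - {x}. s z - s x)) = 0"
proof -
  define a where "a x = poly P (s x) / (\<Prod>z\<in>I - {x}. s z - s x)" for x
  define L where "L x = (\<Prod>z\<in>I - {x}. [:s z, - 1:])" for x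
  define Q where "Q = (\<Sum>x\<in>I. Polynomial.smult (a x) (L x))"
  have L: "degree (L x) \<le> card I - 1" "coeff (L x) (card I - 1) = (- 1) ^ (card I - 1)" if "x \<in> I" for x
    using coeff_prod_linear[of "I - {x}" s] that fin by (auto simp: L_def)
  have eval: "poly Q (s y) = poly P (s y)" if y: "y \<in> I" for y
  proof -
    have "poly Q (s y) = (\<Sum>x\<in>I. a x * (\<Prod>z\<in>I - {x}. s z - s y))"
      by (simp add: Q_def poly_sum L_def poly_prod)
    also have "\<dots> = (\<Sum>x\<in>{y}. a x * (\<Prod>z\<in>I - {x}. s z - s y))"
      using fin y by (intro sum.mono_neutral_right) auto
    also have "\<dots> = poly P (s y)"
    proof -
      have "(\<Prod>z\<in>I - {y}. s z - s y) \<noteq> 0" using fin inj y by (auto simp: inj_on_def)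
      then show ?thesis by (simp add: a_def)
    qed
    finally show ?thesis .
  qed
  have "degree Q \<le> card I - 1"
    unfolding Q_def using L fin by (intro degree_sum_le) (auto intro: order.trans[OF degree_smult_le])
  then have dQP: "degree (Q - P) \<le> card I - 1" using deg by (intro degree_diff_le) auto
  have "Q - P = 0"
  proof (rule ccontr)
    assume nz: "Q - P \<noteq> 0"
    have "card I = card (s ` I)" using inj by (simp add: card_image)
    also have "\<dots> \<le> card {x. poly (Q - P) x = 0}"
      using eval poly_roots_finite[OF nz] by (intro card_mono) auto
    also have "\<dots> \<le> degree (Q - P)" using nz by (rule card_poly_roots_bound)
    finally show False using dQP deg by simp
  qed
  then have "coeff Q (card I - 1) = coeff P (card I - 1)" by simp
  also have "\<dots> = 0" using deg by (intro coeff_eq_0) simp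
  also have "coeff Q (card I - 1) = (\<Sum>x\<in>I. a x * (- 1) ^ (card I - 1))"
    unfolding Q_def coeff_sum coeff_smult using L(2) by (intro sum.cong) auto
  finally have "(\<Sum>x\<in>I. a x) = 0" by (simp flip: sum_distrib_right)
  then show ?thesis by (simp add: a_def)
qed

lemma finite_field_power_card_minus_1:
  fixes c :: "'a::{field,finite}"
  assumes "c \<noteq> 0"
  shows "c ^ (CARD('a) - 1) = 1"
proof -
  have "(\<Prod>x\<in>UNIV - {0}. c * x) = (\<Prod>x\<in>UNIV - {0}. x)"
    by (rule prod.reindex_bij_witness[of _ "\<lambda>x. x / c" "\<lambda>x. c * x"]) (use assms in auto)
  moreover have "(\<Prod>x\<in>UNIV - {0}. c * x) = c ^ (CARD('a) - 1) * (\<Prod>x\<in>UNIV - {0}. x)"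
    by (simp add: prod.distrib card_Diff_singleton)
  moreover have "(\<Prod>x\<in>UNIV - {0 :: 'a}. x) \<noteq> 0" by simp
  ultimately show ?thesis by simp
qed

lemma prod_differences:
  fixes t :: "'a::{field,finite}"
  shows "(\<Prod>r\<in>UNIV - {t}. r - t) = (\<Prod>r\<in>UNIV - {0}. r)"
  by (rule prod.reindex_bij_witness[of _ "\<lambda>x. x + t" "\<lambda>x. x - t"]) auto

section \<open>A row relation from an arc of size \<open>q + 2\<close>\<close>

locale finite_arc = arc k G for k and G :: "'a::{field,finite} vec list"
begin

text \<open>The coefficients of the opening comment: its large arc \<open>S\<close> is the
  \<open>G\<close> of the locale, and \<open>X\<close> indexes the subfamily of size
  \<open>2k - 2\<close>.\<close>

definition arc_weight :: "nat set \<Rightarrow> nat set \<Rightarrow> 'a" where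
  "arc_weight X C = 1 / ((\<Prod>w\<in>{..<length G} - C. arc_det k G w C) * (\<Prod>z\<in>X - C. arc_det k G z C))"

text \<open>The determinant of \<open>u\<close> and \<open>x\<close> after projection from
  \<open>A\<close>. Placing \<open>x\<close> before \<open>A\<close>, not at its inherited position,
  makes it antisymmetric in \<open>u\<close> and \<open>x\<close>.\<close>

definition bracket :: "nat set \<Rightarrow> nat \<Rightarrow> nat \<Rightarrow> 'a" where
  "bracket A u x = det (mat_of_rows k (G ! u # G ! x # nths G A))"

context
  fixes A :: "nat set"
  assumes A: "A \<subseteq> {..<length G}" "card A + 2 = k"
begin

lemma finite_A: "finite A"
  using finite_subset[OF A(1)] by simp

lemma bracket_swap: "bracket A u x = - bracket A x u"
proof -
  have "length ([] @ G ! u # G ! x # nths G A) = k" using A by (simp add: length_nths_subset)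
  from det_rows_swap_adjacent[OF this] show ?thesis by (simp only: bracket_def append_Nil)
qed

text \<open>Moving \<open>x\<close> to its inherited position costs a sign that is the same for all
  \<open>u\<close>, so the signs in the weights collect to powers of one \<open>e\<close>.\<close>

lemma arc_det_insert:
  assumes "x < length G" "x \<notin> A"
  shows "\<exists>e. (e = 1 \<or> e = - 1) \<and> (\<forall>u. arc_det k G u (insert x A) = e * bracket A u x)"
proof -
  obtain ys zs where yz: "nths G (insert x A) = ys @ G ! x # zs" "nths G A = ys @ zs"
    using nths_insert[OF assms] by blast
  have "length (ys @ zs) + 2 = k" using A length_nths_subset[OF A(1)] yz by simp
  then have "arc_det k G u (insert x A) = (- 1) ^ length ys * bracket A u x" for u
    using det_rows_move[of "[G ! u]" ys "G ! x" zs k] by (simp add: arc_det_def bracket_def yz)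
  then show ?thesis by (metis neg_one_even_power neg_one_odd_power)
qed

lemma bracket_eq_0:
  assumes "x < length G" "x \<notin> A" "u \<in> insert x A"
  shows "bracket A u x = 0"
proof -
  obtain e where e: "e = 1 \<or> e = - 1" "\<forall>u. arc_det k G u (insert x A) = e * bracket A u x"
    using arc_det_insert[OF assms(1,2)] by blast
  have "arc_det k G u (insert x A) = 0"
    using A assms finite_A by (intro arc_det_eq_0) auto
  then show ?thesis using e by auto
qed

lemma bracket_neq_0:
  assumes "x < length G" "x \<notin> A" "u < length G" "u \<notin> A" "u \<noteq> x"
  shows "bracket A u x \<noteq> 0"
proof -
  obtain e where e: "e = 1 \<or> e = - 1" "\<forall>u. arc_det k G u (insert x A) = e * bracket A u x"
    using arc_det_insert[OF assms(1,2)] by blast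
  have "arc_det k G u (insert x A) \<noteq> 0"
    using A assms finite_A by (intro arc_det_neq_0) auto
  then show ?thesis using e by auto
qed

text \<open>The three-term Pluecker relation. The difference of its sides is linear in
  \<open>w\<close> and vanishes at \<open>u\<close>, at \<open>x\<close> and on \<open>A\<close>; a
  dependency between these \<open>k\<close> points and \<open>w\<close> forces it to vanish at
  \<open>w\<close>.\<close>

lemma bracket_pluecker:
  assumes "{u, x, w, y} \<subseteq> {..<length G} - A" "u \<noteq> x" "u \<noteq> w" "x \<noteq> w"
  shows "bracket A w x * bracket A u y = bracket A u x * bracket A w y - bracket A u w * bracket A x y"
proof -
  let ?U = "A \<union> {u, x, w}"
  have U: "?U \<subseteq> {..<length G}" "card ?U = Suc k"
  proof -
    have "card ?U = card A + card {u, x, w}"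
      using assms finite_A by (intro card_Un_disjoint) auto
    then show "card ?U = Suc k" using assms A by simp
  qed (use assms A in auto)
  obtain l where l: "\<forall>v\<in>?U. l v \<noteq> 0"
    "\<forall>L. Suc (length L) = k \<longrightarrow> (\<Sum>v\<in>?U. l v * det (mat_of_rows k (G ! v # L))) = 0"
    using arc_det_dependency[OF U] by blast
  have lin: "(\<Sum>v\<in>?U. l v * bracket A v z) = 0" for z
    using l(2)[rule_format, of "G ! z # nths G A"] A by (simp add: bracket_def length_nths_subset)
  define F where "F v = bracket A v x * bracket A u y - bracket A u x * bracket A v y - bracket A v u * bracket A x y" for v
  have "(\<Sum>v\<in>?U. l v * F v) = (\<Sum>v\<in>?U. l v * bracket A v x) * bracket A u y -
      bracket A u x * (\<Sum>v\<in>?U. l v * bracket A v y) - (\<Sum>v\<in>?U. l v * bracket A v u) * bracket A x y"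
    unfolding F_def sum_distrib_left sum_distrib_right sum_subtractf[symmetric]
    by (rule sum.cong) (simp_all add: algebra_simps)
  then have "(\<Sum>v\<in>?U. l v * F v) = 0" by (simp only: lin) simp
  moreover have "(\<Sum>v\<in>?U. l v * F v) = (\<Sum>v\<in>{w}. l v * F v)"
  proof (rule sum.mono_neutral_right)
    have b0: "bracket A v z = 0" if "v \<in> insert z A" "z \<in> {u, x, w, y}" for v z
      using bracket_eq_0[of z v] that assms(1) by auto
    have "F v = 0" if "v \<in> A" for v using that by (simp add: F_def b0)
    moreover have "F u = 0" by (simp add: F_def b0)
    moreover have "F x = 0" using bracket_swap[of u x] by (simp add: F_def b0)
    ultimately show "\<forall>v\<in>?U - {w}. l v * F v = 0" by auto
  qed (use finite_A in auto)
  ultimately have "F w = 0" using l(1) by simp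
  then show ?thesis using bracket_swap[of w u] by (simp add: F_def algebra_simps)
qed

text \<open>
  Projecting from \<open>A\<close> sends the other points to a projective line, and \<open>s x\<close> is the affine
  coordinate of \<open>x\<close> on it when \<open>u\<close> is put at infinity.
\<close>

lemma bracket_slopes:
  assumes u: "u < length G" "u \<notin> A"
  shows "\<exists>s K. K \<noteq> 0 \<and> inj_on s ({..<length G} - A - {u}) \<and>
    (\<forall>w \<in> {..<length G} - A - {u}. \<forall>x \<in> {..<length G} - A - {u}.
       bracket A w x = bracket A u w * bracket A u x * (s w - s x) * K)"
proof -
  let ?W = "{..<length G} - A - {u}"
  have "card ({..<length G} - A) = length G - card A"
    using A finite_A by (simp add: card_Diff_subset)
  then have "0 < card ?W" using u A is_arc by (simp add: card_Diff_singleton is_arc_def)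
  then obtain y where y: "y \<in> ?W" by (metis card_gt_0_iff ex_in_conv)
  \<comment> \<open>The arbitrary point \<open>y\<close> becomes the origin of the affine
    line.\<close>
  define s where "s x = bracket A x y / bracket A u x" for x
  define K where "K = 1 / bracket A u y"
  have K: "bracket A u y \<noteq> 0" using y u by (intro bracket_neq_0) auto
  have eq: "bracket A w x = bracket A u w * bracket A u x * (s w - s x) * K" if wx: "w \<in> ?W" "x \<in> ?W" for w x
  proof (cases "w = x")
    case True
    then show ?thesis using bracket_eq_0[of x x] wx by simp
  next
    case False
    have nz: "bracket A u w \<noteq> 0" "bracket A u x \<noteq> 0" 
      using wx u bracket_neq_0[of w u] bracket_neq_0[of x u] by auto
    have "bracket A w x * bracket A u y = bracket A u x * bracket A w y - bracket A u w * bracket A x y"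
      by (rule bracket_pluecker) (use wx u y False in auto)
    also have "\<dots> = bracket A u w * bracket A u x * (s w - s x)"
      using nz by (simp add: s_def right_diff_distrib)
    finally show ?thesis using K by (simp add: K_def nonzero_eq_divide_eq)
  qed
  have inj: "inj_on s ?W"
  proof (rule inj_onI, rule ccontr)
    fix w x assume wx: "w \<in> ?W" "x \<in> ?W" "s w = s x" "w \<noteq> x"
    then have "bracket A w x = 0" using eq by simp
    moreover have "bracket A w x \<noteq> 0" using wx by (intro bracket_neq_0) auto
    ultimately show False by simp
  qed
  have "K \<noteq> 0" using K by (simp add: K_def)
  show ?thesis
    by (rule exI[of _ s], rule exI[of _ K]) (intro conjI ballI \<open>K \<noteq> 0\<close> inj eq)
qed

text \<open>Up to the factor \<open>1 / D\<close>, common to all \<open>x\<close>, each summand is a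
  term of the divided difference of \<open>P\<close> at the slopes of \<open>E\<close>.\<close>

lemma cancel_weights:
  assumes n: "length G = CARD('a) + 2"
    and X: "X \<subseteq> {..<length G}" "card X + 2 = 2 * k" "A \<subseteq> X" and u: "u \<in> X - A"
  shows "(\<Sum>x\<in>X - A. arc_weight X (insert x A) * arc_det k G u (insert x A)) = 0"
proof -
  define W where "W = {..<length G} - A - {u}"
  define E where "E = X - A - {u}"
  have uG: "u < length G" "u \<notin> A" using u X by auto
  have finX: "finite X" using X finite_subset by blast
  have EW: "E \<subseteq> W" "finite W" "finite E" using X finX by (auto simp: E_def W_def)
  obtain s K where K: "K \<noteq> 0" and inj: "inj_on s W" and slope:
    "\<And>w x. w \<in> W \<Longrightarrow> x \<in> W \<Longrightarrow> bracket A w x = bracket A u w * bracket A u x * (s w - s x) * K"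
    using bracket_slopes[OF uG] unfolding W_def by blast
  have injE: "inj_on s E" using inj EW(1) inj_on_subset by blast
  have cardW: "card W + k = CARD('a) + 3"
  proof -
    have "card ({..<length G} - A) = length G - card A"
      using A finite_A by (simp add: card_Diff_subset)
    moreover have "card A < length G" using is_arc A by (simp add: is_arc_def)
    ultimately show ?thesis using uG A n by (simp add: W_def card_Diff_singleton)
  qed
  have cardE: "card E + 1 = k"
  proof -
    have "card (X - A) = card X - card A" using X finite_A by (simp add: card_Diff_subset)
    then show ?thesis using u X A finX by (simp add: E_def card_Diff_singleton)
  qed
  \<comment> \<open>\<open>W\<close> yields \<open>q + 3 - k\<close> slopes, which leaves
    \<open>k - 3\<close> elements, while \<open>E\<close> has \<open>k - 1\<close> nodes.\<close>
  define R where "R = UNIV - s ` W"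
  define P where "P = (\<Prod>r\<in>R. [:r, - 1:])"
  have "card (s ` W) = card W" using inj by (rule card_image)
  then have cardR: "card R + card W = CARD('a)"
    using card_mono[of UNIV "s ` W"] by (simp add: R_def card_Diff_subset)
  have "degree P \<le> card R" unfolding P_def using coeff_prod_linear[of R "\<lambda>r. r"] by simp
  then have degP: "degree P + 1 < card E" using cardR cardW cardE by linarith
  define \<kappa> :: 'a where "\<kappa> = (\<Prod>r\<in>UNIV - {0}. r)"
  have \<kappa>: "\<kappa> \<noteq> 0" by (simp add: \<kappa>_def)
  let ?b = "bracket A u"
  define D where "D = (\<Prod>w\<in>W. ?b w) * (\<Prod>z\<in>E. ?b z) * K ^ (CARD('a)) * \<kappa>"
  have b0: "?b x \<noteq> 0" if "x \<in> W" for x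
    using bracket_neq_0[of x u] that uG by (auto simp: W_def)
  have summand: "arc_weight X (insert x A) * arc_det k G u (insert x A) =
      (1 / D) * (poly P (s x) / (\<Prod>z\<in>E - {x}. s z - s x))" if x: "x \<in> E" for x
  proof -
    have xW: "x \<in> W" using x EW by auto
    then have x': "x < length G" "x \<notin> A" "x \<noteq> u" by (auto simp: W_def)
    obtain e where e: "e = 1 \<or> e = - 1" "\<And>u. arc_det k G u (insert x A) = e * bracket A u x"
      using arc_det_insert[OF x'(1,2)] by blast
    have pow: "c ^ (CARD('a) - 1) = 1" if "c \<noteq> 0" for c :: 'a
      using finite_field_power_card_minus_1[OF that] .
    have q: "1 < CARD('a)"
      using card_mono[of UNIV "{0, 1 :: 'a}"] by simp
    \<comment> \<open>The factor \<open>?b x\<close> closes the gap at \<open>x\<close>, so that the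
      product of the brackets over \<open>F\<close> no longer depends on \<open>x\<close>.\<close>
    have prods: "(\<Prod>w\<in>F - {x}. arc_det k G w (insert x A)) * ?b x =
        e ^ (card F - 1) * (\<Prod>w\<in>F. ?b w) * ?b x ^ (card F - 1) * K ^ (card F - 1) * (\<Prod>w\<in>F - {x}. s w - s x)"
      if F: "F \<subseteq> W" "x \<in> F" for F
    proof -
      have finF: "finite F" using F EW finite_subset by blast
      have "(\<Prod>w\<in>F - {x}. arc_det k G w (insert x A)) =
          (\<Prod>w\<in>F - {x}. e * ?b w * ?b x * K * (s w - s x))"
      proof (rule prod.cong)
        fix w assume "w \<in> F - {x}"
        then show "arc_det k G w (insert x A) = e * ?b w * ?b x * K * (s w - s x)"
          using e(2) slope[of w x] F xW by (auto simp: mult_ac)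
      qed simp
      also have "\<dots> = e ^ (card F - 1) * (\<Prod>w\<in>F - {x}. ?b w) * ?b x ^ (card F - 1) * K ^ (card F - 1) * (\<Prod>w\<in>F - {x}. s w - s x)"
        using finF F by (simp add: prod.distrib card_Diff_singleton)
      finally show ?thesis
        using prod.remove[OF finF F(2), of ?b] by (simp add: mult_ac)
    qed
    define PW where "PW = (\<Prod>w\<in>W - {x}. arc_det k G w (insert x A))"
    define PE where "PE = (\<Prod>z\<in>E - {x}. arc_det k G z (insert x A))"
    define SE where "SE = (\<Prod>z\<in>E - {x}. s z - s x)"
    define SW where "SW = (\<Prod>w\<in>W - {x}. s w - s x)"
    have "card W \<ge> 1" "card E \<ge> 1" using degP EW card_mono[OF EW(2,1)] by auto
    \<comment> \<open>Both products together have exactly \<open>q\<close> factors, so the powers of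
      \<open>e\<close> and \<open>?b x\<close> are \<open>q\<close>-th powers and reduce to
      \<open>e\<close> and \<open>?b x\<close>.\<close>
    then have cards: "card W - 1 + (card E - 1) = CARD('a)"
      using cardW cardE by linarith
    have ad: "arc_det k G u (insert x A) = e * bracket A u x" by (rule e(2))
    have w1: "{..<length G} - insert x A = insert u (W - {x})" "u \<notin> W - {x}" "finite (W - {x})"
      using uG x' EW by (auto simp: W_def)
    have w2: "X - insert x A = insert u (E - {x})" "u \<notin> E - {x}" "finite (E - {x})"
      using u x' EW by (auto simp: E_def)
    have weight: "arc_weight X (insert x A) = 1 / (e * ?b x * PW * (e * ?b x * PE))"
      unfolding arc_weight_def w1(1) w2(1) prod.insert[OF w1(3,2)] prod.insert[OF w2(3,2)] ad PW_def PE_def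
      by simp
    have PP: "PW * ?b x * (PE * ?b x) = e ^ CARD('a) * ?b x ^ CARD('a) * K ^ CARD('a) * (\<Prod>w\<in>W. ?b w) * (\<Prod>z\<in>E. ?b z) * (SW * SE)"
      unfolding PW_def PE_def prods[OF order.refl xW] prods[OF EW(1) x] SW_def SE_def cards[symmetric] power_add
      by (simp only: mult_ac)
    have qS: "CARD('a) = Suc (CARD('a) - 1)" using q by simp
    have e0: "e \<noteq> 0" "e * e = 1" using e(1) by auto
    have bq: "?b x ^ CARD('a) = ?b x" "e ^ CARD('a) = e"
      by (subst qS, simp only: power_Suc pow[OF b0[OF xW]] mult_1_right,
          subst qS, simp only: power_Suc pow[OF e0(1)] mult_1_right)
    \<comment> \<open>The slopes of \<open>W - {x}\<close> and the elements of \<open>R\<close>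
      exhaust the field except \<open>s x\<close>. Hence \<open>1 / SW\<close> is a constant times
      \<open>poly P (s x)\<close>.\<close>
    have SWP: "SW * poly P (s x) = \<kappa>"
    proof -
      have "SW = (\<Prod>r\<in>s ` (W - {x}). r - s x)"
        unfolding SW_def using inj by (subst prod.reindex) (auto intro: inj_on_subset)
      moreover have "poly P (s x) = (\<Prod>r\<in>R. r - s x)" by (simp add: P_def poly_prod)
      moreover have "s ` (W - {x}) \<union> R = UNIV - {s x}" "s ` (W - {x}) \<inter> R = {}"
        using inj xW by (auto simp: R_def inj_on_def)
      ultimately have "SW * poly P (s x) = (\<Prod>r\<in>UNIV - {s x}. r - s x)"
        using prod.union_disjoint[of "s ` (W - {x})" R "\<lambda>r. r - s x"] by simp
      then show ?thesis by (simp add: prod_differences \<kappa>_def)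
    qed
    have SE0: "SE \<noteq> 0" using injE x EW unfolding SE_def by (auto simp: inj_on_def)
    have SW0: "SW \<noteq> 0" "poly P (s x) \<noteq> 0" using SWP \<kappa> by auto
    have "arc_weight X (insert x A) * arc_det k G u (insert x A) = e * ?b x / (PW * ?b x * (PE * ?b x))"
      unfolding weight ad using e(1) by (elim disjE) (simp_all add: mult_ac)
    also have "\<dots> = 1 / ((\<Prod>w\<in>W. ?b w) * (\<Prod>z\<in>E. ?b z) * K ^ CARD('a) * (SW * SE))"
      unfolding PP bq using e0(1) b0[OF xW] by (simp add: mult_ac)
    also have "\<dots> = (1 / D) * (poly P (s x) / SE)"
      unfolding D_def using SW0 by (simp add: mult_ac flip: SWP)
    finally show ?thesis by (simp add: SE_def)
  qed
  have "(\<Sum>x\<in>X - A. arc_weight X (insert x A) * arc_det k G u (insert x A)) =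
      (\<Sum>x\<in>E. arc_weight X (insert x A) * arc_det k G u (insert x A))"
  proof (rule sum.mono_neutral_right)
    have "arc_det k G u (insert u A) = 0" using uG A finite_A by (intro arc_det_eq_0) auto
    then show "\<forall>x\<in>X - A - E. arc_weight X (insert x A) * arc_det k G u (insert x A) = 0"
      by (auto simp: E_def)
  qed (use finX in \<open>auto simp: E_def\<close>)
  also have "\<dots> = (\<Sum>x\<in>E. (1 / D) * (poly P (s x) / (\<Prod>z\<in>E - {x}. s z - s x)))"
    using summand by (rule sum.cong[OF refl])
  also have "\<dots> = (1 / D) * (\<Sum>x\<in>E. poly P (s x) / (\<Prod>z\<in>E - {x}. s z - s x))"
    by (simp only: sum_distrib_left)
  also have "\<dots> = 0" using divided_difference_eq_0[OF EW(3) injE degP] by simp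
  finally show ?thesis .
qed

end

end

section \<open>The upper bound on arc sizes\<close>

lemma prime_CHAR_finite_field: "prime CHAR('a::{field,finite})"
  by (intro prime_CHAR_semidom finite_imp_CHAR_pos) simp

text \<open>The first \<open>2k - 2\<close> positions fit into the arc by the second assumption.
  There \<open>v_eq_0\<close> would make a weight times a determinant vanish, although both are
  nonzero.\<close>

lemma (in finite_arc) length_neq_CARD_plus_2:
  assumes "k \<le> 2 * CHAR('a) - 2" "2 * k \<le> CARD('a) + 4"
  shows "length G \<noteq> CARD('a) + 2"
proof
  assume n: "length G = CARD('a) + 2"
  let ?X = "{..<2 * k - 2}"
  have X: "?X \<subseteq> {..<length G}" using assms(2) n by auto
  have cX: "card ?X + 2 = 2 * k" using k_ge_2 by simp
  have "cancelling_system ?X (k - 1) (\<lambda>C u. arc_weight ?X C * arc_det k G u C)"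
  proof (rule cancelling_systemI)
    show "prime CHAR('a)" by (rule prime_CHAR_finite_field)
    fix A u assume A: "A \<subseteq> ?X" "card A + 2 = k" "u \<in> ?X - A"
    have "A \<subseteq> {..<length G}" using A(1) X by (rule order.trans)
    then show "(\<Sum>x\<in>?X - A. arc_weight ?X (insert x A) * arc_det k G u (insert x A)) = 0"
      using A by (intro cancel_weights[OF _ _ n X cX])
  qed (use assms X cX in auto)
  then interpret cancelling_system ?X "k - 1" "\<lambda>C u. arc_weight ?X C * arc_det k G u C" .
  let ?C = "{..<k - 1}"
  have C: "?C \<subseteq> ?X" "card ?C = k - 1" by auto
  have nz: "arc_det k G w ?C \<noteq> 0" if "w < length G" "w \<notin> ?C" for w
    using that C X k_ge_2 by (intro arc_det_neq_0) auto
  have "arc_weight ?X ?C * arc_det k G (k - 1) ?C = 0"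
    using v_eq_0[OF C] k_ge_2 by simp
  moreover have "arc_weight ?X ?C \<noteq> 0"
    using nz X by (auto simp: arc_weight_def)
  moreover have "arc_det k G (k - 1) ?C \<noteq> 0"
    using nz[of "k - 1"] n k_ge_2 assms(2) by auto
  ultimately show False by simp
qed

lemma is_arc_take:
  assumes "is_arc k G" "k \<le> n" "n \<le> length G"
  shows "is_arc k (take n G)"
proof -
  have "basis_family k (nths (take n G) I)" if I: "I \<subseteq> {..<n}" "card I = k" for I
  proof -
    have "nths (take n G) I = nths G I"
    proof -
      have "nths G I = nths (take n G @ drop n G) I" by simp
      also have "\<dots> = nths (take n G) I @ nths (drop n G) {j. j + length (take n G) \<in> I}"
        by (rule nths_append)
      also have "{j. j + length (take n G) \<in> I} = {}" using I assms by auto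
      finally show ?thesis by simp
    qed
    moreover have "I \<subseteq> {..<length G}" using I assms by auto
    ultimately show ?thesis using assms(1) I by (auto simp: is_arc_def)
  qed
  moreover have "set (take n G) \<subseteq> carrier_vec k"
    using assms(1) set_take_subset[of n G] by (auto simp: is_arc_def)
  ultimately show ?thesis using assms by (auto simp: is_arc_def)
qed

lemma arc_length_le:
  fixes G :: "'a::{field,finite} vec list"
  assumes "is_arc k G" "2 \<le> k" "k \<le> 2 * CHAR('a) - 2" "2 * k \<le> CARD('a) + 4"
  shows "length G \<le> CARD('a) + 1"
proof (rule ccontr)
  assume "\<not> length G \<le> CARD('a) + 1"
  then have n: "CARD('a) + 2 \<le> length G" by simp
  have "k \<le> CARD('a) + 2" using assms(2,4) by simp
  then have "is_arc k (take (CARD('a) + 2) G)" using is_arc_take[OF assms(1) _ n] by simp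
  then interpret finite_arc k "take (CARD('a) + 2) G"
    using assms(2) by unfold_locales
  show False using length_neq_CARD_plus_2 assms n by simp
qed

section \<open>An arc of size \<open>q + 1\<close>\<close>

definition moment_vec :: "nat \<Rightarrow> 'a::field \<Rightarrow> 'a vec" where
  "moment_vec k t = vec k (\<lambda>j. t ^ j)"

text \<open>The witness is the normal rational curve, that is, the moment curve with its point at infinity.\<close>

lemma exists_arc_CARD_plus_1:
  assumes k: "1 \<le> k" "k \<le> CARD('a::{field,finite}) + 1"
  shows "\<exists>G :: 'a vec list. is_arc k G \<and> length G = CARD('a) + 1"
proof -
  obtain ts :: "'a list" where ts: "set ts = UNIV" "distinct ts"
    using finite_distinct_list[of "UNIV :: 'a set"] by auto
  have len: "length ts = CARD('a)" using ts distinct_card by metis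
  define q where "q = CARD('a)"
  define G where "G = map (moment_vec k) ts @ [unit_vec k (k - 1)]"
  have lenG: "length G = q + 1" using len by (simp add: G_def q_def)
  have GG: "set G \<subseteq> carrier_vec k" by (auto simp: G_def moment_vec_def)
  have "basis_family k (nths G I)" if I: "I \<subseteq> {..<length G}" "card I = k" for I
  proof (rule basis_familyI)
    show lenI: "length (nths G I) = k" using I by (simp add: length_nths_subset)
    show "set (nths G I) \<subseteq> carrier_vec k" using GG set_nths_subset by fastforce
    let ?M = "mat_of_rows k (nths G I)"
    have M: "?M \<in> carrier_mat k k" using lenI by auto
    have finI: "finite I" using finite_subset[OF I(1)] by simp
    show "det ?M \<noteq> 0"
    proof
      assume "det ?M = 0"
      then obtain c where c: "c \<in> carrier_vec k" "c \<noteq> 0\<^sub>v k" "?M *\<^sub>v c = 0\<^sub>v k"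
        using det_0_iff_vec_prod_zero[OF M] by blast
      have orth: "(\<Sum>j<k. G ! i $ j * c $ j) = 0" if i: "i \<in> I" for i
      proof -
        have "G ! i \<in> set (nths G I)" using i I by (auto simp: set_nths)
        then obtain r where r: "r < k" "nths G I ! r = G ! i" using lenI by (metis in_set_conv_nth)
        have Gi: "G ! i \<in> carrier_vec k" using i I GG nth_mem by blast
        have "0 = (?M *\<^sub>v c) $ r" using c r by simp
        also have "\<dots> = row ?M r \<bullet> c" by (rule index_mult_mat_vec) (use r lenI in simp)
        also have "row ?M r = G ! i" using mat_of_rows_row[of r "nths G I" k] r lenI Gi by simp
        also have "G ! i \<bullet> c = (\<Sum>j<k. G ! i $ j * c $ j)"
          using c(1) by (simp add: scalar_prod_def atLeast0LessThan)
        finally show ?thesis by simp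
      qed
      \<comment> \<open>A kernel vector is read as a polynomial of degree below \<open>k\<close>;
        orthogonality to a point of the moment curve means vanishing at its parameter.\<close>
      define P where "P = (\<Sum>j<k. monom (c $ j) j)"
      have coeffP: "coeff P j = (if j < k then c $ j else 0)" for j
        by (simp add: P_def coeff_sum)
      have polyP: "poly P t = (\<Sum>j<k. moment_vec k t $ j * c $ j)" for t
        by (simp add: P_def poly_sum poly_monom moment_vec_def mult.commute)
      obtain j where "j < k" "c $ j \<noteq> 0"
        using c(1,2) by (metis carrier_vecD eq_vecI index_zero_vec(1) index_zero_vec(2))
      then have P0: "P \<noteq> 0" using coeffP[of j] by auto
      have deg: "degree P \<le> k - 1" by (rule degree_le) (use k in \<open>auto simp: coeffP\<close>)
      have roots: "poly P (ts ! i) = 0" if "i \<in> I" "i < q" for i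
        using orth[OF that(1)] that(2) len by (simp add: polyP G_def nth_append q_def)
      have "card (I - {q}) = card ((!) ts ` (I - {q}))"
      proof (rule card_image[symmetric])
        show "inj_on ((!) ts) (I - {q})"
          using I lenG ts(2) len by (intro inj_on_nth) (auto simp: q_def)
      qed
      also have "\<dots> \<le> card {t. poly P t = 0}"
        using roots I lenG poly_roots_finite[OF P0] by (intro card_mono) force+
      also have "\<dots> \<le> degree P" by (rule card_poly_roots_bound[OF P0])
      finally have le: "card (I - {q}) \<le> degree P" .
      show False
      proof (cases "q \<in> I")
        case False
        then show False using le deg I k by simp
      next
        case True
        \<comment> \<open>Position \<open>q\<close> is the point at infinity. Orthogonality to it
          removes the coefficient of degree \<open>k - 1\<close>, so the other \<open>k - 1\<close>
          points give too many roots.\<close>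
        have "G ! q $ j = (if j = k - 1 then 1 else 0)" if "j < k" for j
          using that len k by (simp add: G_def nth_append q_def)
        then have "(\<Sum>j<k. G ! q $ j * c $ j) = (\<Sum>j<k. if j = k - 1 then c $ j else 0)"
          by (intro sum.cong) auto
        then have "c $ (k - 1) = 0" using orth[OF True] k by simp
        then have "coeff P (k - 1) = 0" by (simp add: coeffP)
        then have "degree P \<noteq> k - 1" using P0 by (metis leading_coeff_0_iff)
        then have "degree P < k - 1" using deg by simp
        then show False using le I True finI by (simp add: card_Diff_singleton)
      qed
    qed
  qed
  moreover have "k \<le> length G" using k lenG by (simp add: q_def)
  ultimately show ?thesis using GG lenG by (auto simp: is_arc_def q_def)
qed

text \<open>The prime field \<open>F\<close> has \<open>p\<close> elements and is proper, as
  \<open>q\<close> is not prime. Any \<open>\<theta>\<close> outside it yields \<open>p^2\<close>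
  distinct elements \<open>x + y * \<theta>\<close>.\<close>

lemma CHAR_square_le_CARD:
  assumes "\<not> prime CARD('a::{field,finite})"
  shows "CHAR('a) ^ 2 \<le> CARD('a)"
proof -
  define p where "p = CHAR('a)"
  have p: "prime p" unfolding p_def by (rule prime_CHAR_finite_field)
  define F where "F = range (of_nat :: nat \<Rightarrow> 'a)"
  have F_eq: "F = of_nat ` {..<p}"
  proof -
    have "(of_nat i :: 'a) \<in> of_nat ` {..<p}" for i
    proof -
      have "(of_nat i :: 'a) = of_nat (i mod p)"
        by (simp add: of_nat_eq_iff_cong_CHAR p_def cong_def)
      then show ?thesis using p prime_gt_0_nat by (auto intro!: image_eqI[of _ _ "i mod p"])
    qed
    then show ?thesis by (auto simp: F_def)
  qed
  have inj: "inj_on (of_nat :: nat \<Rightarrow> 'a) {..<p}"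
    by (auto simp: inj_on_def of_nat_eq_iff_cong_CHAR p_def cong_def)
  have cardF: "card F = p" unfolding F_eq using inj by (simp add: card_image)
  have F_mult: "x * y \<in> F" if "x \<in> F" "y \<in> F" for x y
    using that by (auto simp: F_def simp flip: of_nat_mult)
  have F_minus1: "- 1 \<in> F"
  proof -
    have "(of_nat (p - 1) :: 'a) + 1 = of_nat p" using p prime_gt_0_nat[of p]
      by (metis One_nat_def Suc_pred of_nat_Suc add.commute)
    then have "of_nat (p - 1) = (- 1 :: 'a)" by (simp add: p_def eq_neg_iff_add_eq_0)
    then show ?thesis by (metis F_def rangeI)
  qed
  have F_add: "x + y \<in> F" if "x \<in> F" "y \<in> F" for x y
    using that by (auto simp: F_def simp flip: of_nat_add)
  have F_diff: "x - y \<in> F" if "x \<in> F" "y \<in> F" for x y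
    using F_add[OF that(1) F_mult[OF F_minus1 that(2)]] by simp
  have F_power: "x ^ i \<in> F" if "x \<in> F" for x i
    using that by (auto simp: F_def simp flip: of_nat_power)
  have F_div: "x / y \<in> F" if "x \<in> F" "y \<in> F" "y \<noteq> 0" for x y
  proof -
    have q: "1 < CARD('a)" using card_mono[of UNIV "{0, 1 :: 'a}"] by simp
    \<comment> \<open>The inverse of \<open>y\<close> is a power of \<open>y\<close>, so closure
      under products suffices.\<close>
    have "y * y ^ (CARD('a) - 2) = 1"
      using finite_field_power_card_minus_1[OF that(3)] q
      by (metis Suc_diff_Suc numeral_2_eq_2 One_nat_def power_Suc)
    then have "x / y = x * y ^ (CARD('a) - 2)" using that(3) by (simp add: field_simps)
    then show ?thesis using F_mult[OF that(1) F_power[OF that(2)]] by simp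
  qed
  have "F \<noteq> UNIV"
  proof
    assume "F = UNIV"
    then have "CARD('a) = p" using cardF by simp
    then show False using p assms by simp
  qed
  then obtain \<theta> where \<theta>: "\<theta> \<notin> F" by auto
  have "inj_on (\<lambda>(x, y). x + y * \<theta>) (F \<times> F)"
  proof (rule inj_onI, clarify)
    fix x y x' y' assume F: "x \<in> F" "y \<in> F" "x' \<in> F" "y' \<in> F" and eq: "x + y * \<theta> = x' + y' * \<theta>"
    have yy: "y = y'"
    proof (rule ccontr)
      assume "y \<noteq> y'"
      then have "\<theta> = (x - x') / (y' - y)" using eq by (simp add: field_simps)
      then show False using F_div[OF F_diff[OF F(1,3)] F_diff[OF F(4,2)]] \<theta> \<open>y \<noteq> y'\<close> by simp
    qed
    then show "x = x' \<and> y = y'" using eq by simp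
  qed
  then have "card (F \<times> F) \<le> CARD('a)" by (rule card_inj_on_le) auto
  then show ?thesis using cardF by (simp add: card_cartesian_product power2_eq_square p_def)
qed

text \<open>\<open>q >= p^2 >= 4p - 4 >= 2k\<close>, the middle step being
  \<open>(p - 2)^2 >= 0\<close>. So both the bound and the construction apply.\<close>

theorem max_arc_size_eq:
  assumes "2 \<le> k" "k \<le> 2 * CHAR('a::{field,finite}) - 2" "\<not> prime CARD('a)"
  shows "max_arc_size TYPE('a) k = CARD('a) + 1"
proof -
  let ?p = "CHAR('a)"
  have sq: "int ?p ^ 2 \<le> int CARD('a)"
    using CHAR_square_le_CARD[OF assms(3)] by (metis of_nat_le_iff of_nat_power)
  have k: "int k \<le> 2 * int ?p - 2" using assms(1,2) by linarith
  have "0 \<le> (int ?p - 2) ^ 2" by simp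
  then have "4 * int ?p - 4 \<le> int ?p ^ 2" by (simp add: power2_diff)
  then have le: "2 * k \<le> CARD('a)" using k sq by linarith
  let ?S = "{length G | G :: 'a vec list. is_arc k G}"
  have bound: "x \<le> CARD('a) + 1" if "x \<in> ?S" for x
    using that arc_length_le[OF _ assms(1,2)] le by auto
  then have "finite ?S" by (meson finite_nat_set_iff_bounded_le)
  moreover have "CARD('a) + 1 \<in> ?S"
  proof -
    have "k \<le> CARD('a) + 1" using le by linarith
    then show ?thesis using exists_arc_CARD_plus_1[of k] assms(1) by force
  qed
  ultimately show ?thesis unfolding max_arc_size_def using bound by (intro Max_eqI) auto
qed

text \<open>\<open>length G + 2 = 2 * k\<close> avoids truncated subtraction, and
  \<open>2 <= k\<close> is the range in which the maximum exists.\<close>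

theorem theorem1p8:
  fixes k :: nat
  assumes "k \<le> 2 * CHAR('a::{field,finite}) - 2"
  shows "(2 * CHAR('a) - 2 \<le> CARD('a) \<longrightarrow>
           (\<forall>(G :: 'a vec list) (B :: 'a vec list).
              is_arc k G \<and> length G + 2 = 2 * k \<and> basis_family k B \<longrightarrow>
              full_row_rank (arc_matrix k B G)))
       \<and> (2 \<le> k \<and> \<not> prime CARD('a) \<longrightarrow> max_arc_size TYPE('a) k = CARD('a) + 1)"
  using full_row_rank_arc_matrix[OF prime_CHAR_finite_field assms] max_arc_size_eq[OF _ assms] by blast

end
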